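(* In the setting of the context, assume $\sigma_{\mathrm{eff,c}}^2=\boldsymbol{w}_{\mathrm c}^\top BB^\top\boldsymbol{w}_{\mathrm c}>0$ and that $\Pr(\bar x=0)=0$ for all $\alpha<\alpha_{\mathrm c}$ sufficiently close to $\alpha_{\mathrm c}$. Let $\boldsymbol{x}=\boldsymbol{x}^*(\alpha)+\boldsymbol{z}$ with $\boldsymbol{z}\sim\mathcal{N}(\boldsymbol{0},C(\alpha))$, let $\mathrm{CV}=\sqrt{V}/|\bar x|$ with $V=\operatorname{Var}(\boldsymbol{x})$, and let $\rho_{\mathrm c}=(\boldsymbol{1}^\top\boldsymbol{v}_{\mathrm c})^2/N\in[0,1]$. Then, as $\alpha\to\alpha_{\mathrm c}^-$, the following hold in probability: (i) if $0<\rho_{\mathrm c}<1$, then $\mathrm{CV}\to\sqrt{\dfrac{N(1-\rho_{\mathrm c})}{(N-1)\rho_{\mathrm c}}}$; (ii) if $\rho_{\mathrm c}=1$, then $\mathrm{CV}\to0$; (iii) if $\rho_{\mathrm c}=0$, then $\mathrm{CV}\to\infty$ in probability.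
   Context: Setting. $N\ge2$. Consider the It\^o SDE $\mathrm d\boldsymbol{x}=F(\boldsymbol{x};\alpha)\,\mathrm dt+B\,\mathrm d\boldsymbol{W}$ in $\mathbb{R}^N$, with $B\in\mathbb{R}^{N\times m}$ constant, $\boldsymbol{W}$ an $m$-dimensional standard Wiener process, and $F$ sufficiently smooth in $(\boldsymbol{x},\alpha)$ ($C^2$ in a neighborhood of the equilibrium branch, including its endpoint at $\alpha_{\mathrm c}$, suffices). $\boldsymbol{x}^*(\alpha)$ is a branch of equilibria, $F(\boldsymbol{x}^*(\alpha);\alpha)=\boldsymbol{0}$, asymptotically stable for $\alpha<\alpha_{\mathrm c}$, and $M(\alpha)=-\frac{\partial F}{\partial\boldsymbol{x}}\big|_{\boldsymbol{x}=\boldsymbol{x}^*(\alpha)}$. $C=C(\alpha)$ is the stationary covariance of the linearized process $\mathrm d\boldsymbol{z}=-M\boldsymbol{z}\,\mathrm dt+B\,\mathrm d\boldsymbol{W}$, i.e. the solution of $MC+CM^\top=BB^\top$. The observed snapshot is modeled (linearized model) as $\boldsymbol{x}=\boldsymbol{x}^*(\alpha)+\boldsymbol{z}$ with $\boldsymbol{z}\sim\mathcal{N}(\boldsymbol{0},C(\alpha))$. Regular simple real critical eigenvalue assumption (in force). As $\alpha\to\alpha_{\mathrm c}^-$, $\boldsymbol{x}^*(\alpha)$ has a finite limit. For $\alpha<\alpha_{\mathrm c}$ close to $\alpha_{\mathrm c}$, $M(\alpha)$ is diagonalizable over $\mathbb{C}$ with all eigenvalues of positive real part; the eigenvalue $\lambda_1(\alpha)$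 of smallest real part is real and simple, $\lambda_1(\alpha)>0$, $\lambda_1(\alpha)\to0$, and $\operatorname{Re}\lambda_k(\alpha)\ge\delta>0$ for $k=2,\dots,N$, with $\delta$ independent of $\alpha$. Real right and left eigenvectors $\boldsymbol{v}(\alpha),\boldsymbol{w}(\alpha)$ are chosen with $M\boldsymbol{v}=\lambda_1\boldsymbol{v}$, $\boldsymbol{w}^\top M=\lambda_1\boldsymbol{w}^\top$, $\|\boldsymbol{v}\|_2=1$, $\boldsymbol{w}^\top\boldsymbol{v}=1$, and they have finite limits $\boldsymbol{v}_{\mathrm c},\boldsymbol{w}_{\mathrm c}$ as $\alpha\to\alpha_{\mathrm c}^-$. Notation: $\bar u=N^{-1}\sum_iu_i$ and $\operatorname{Var}(\boldsymbol{u})=\frac1{N-1}\sum_i(u_i-\bar u)^2$ for $\boldsymbol{u}\in\mathbb{R}^N$. "$\to\infty$ in probability" means that for every $K$, the probability of exceeding $K$ tends to $1$. *)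

theory Defs
  imports "HOL-Probability.Probability" "HOL-Computational_Algebra.Polynomial"
begin

text \<open>Sample mean, sample variance and coefficient of variation of a vector. If the mean is
  zero, HOL's total division makes \<open>cv u\<close> equal to \<open>0\<close>.\<close>

definition vmean :: "real ^ 'n \<Rightarrow> real" where
  "vmean u = (\<Sum>i\<in>UNIV. u $ i) / real CARD('n)"

definition vvar :: "real ^ 'n \<Rightarrow> real" where
  "vvar u = (\<Sum>i\<in>UNIV. (u $ i - vmean u)\<^sup>2) / (real CARD('n) - 1)"

definition cv :: "real ^ 'n \<Rightarrow> real" where
  "cv u = sqrt (vvar u) / \<bar>vmean u\<bar>"

definition C2_on :: "'a::real_normed_vector set \<Rightarrow> ('a \<Rightarrow> 'b::real_normed_vector) \<Rightarrow> bool" where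
  "C2_on U f \<longleftrightarrow> open U \<and>
     (\<exists>(D1 :: 'a \<Rightarrow> 'a \<Rightarrow>\<^sub>L 'b) (D2 :: 'a \<Rightarrow> 'a \<Rightarrow>\<^sub>L 'a \<Rightarrow>\<^sub>L 'b).
        (\<forall>p\<in>U. (f has_derivative blinfun_apply (D1 p)) (at p)) \<and>
        (\<forall>p\<in>U. (D1 has_derivative blinfun_apply (D2 p)) (at p)) \<and>
        continuous_on U D2)"

definition ode_solution ::
    "('a::real_normed_vector \<Rightarrow> 'a) \<Rightarrow> real set \<Rightarrow> (real \<Rightarrow> 'a) \<Rightarrow> bool" where
  "ode_solution f J \<phi> \<longleftrightarrow> (\<forall>t\<in>J. (\<phi> has_vector_derivative f (\<phi> t)) (at t within J))"

text \<open>Asymptotic stability of an equilibrium of \<open>\<phi>' = f \<phi>\<close>: Lyapunov stability and local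
  attractivity. Stability quantifies over solutions on all intervals \<open>[0,T)\<close>, so that solutions
  which do not exist for all times are not ignored.\<close>

definition asymptotically_stable :: "('a::real_normed_vector \<Rightarrow> 'a) \<Rightarrow> 'a \<Rightarrow> bool" where
  "asymptotically_stable f p \<longleftrightarrow>
     (\<forall>\<epsilon>>0. \<exists>\<delta>>0. \<forall>T>0. \<forall>\<phi>. ode_solution f {0..<T} \<phi> \<and> dist (\<phi> 0) p < \<delta> \<longrightarrow>
        (\<forall>t\<in>{0..<T}. dist (\<phi> t) p < \<epsilon>)) \<and>
     (\<exists>\<delta>>0. \<forall>\<phi>. ode_solution f {0..} \<phi> \<and> dist (\<phi> 0) p < \<delta> \<longrightarrow> (\<phi> \<longlongrightarrow> p) at_top)"

definition cmatrix :: "real ^ 'm ^ 'n \<Rightarrow> complex ^ 'm ^ 'n" where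
  "cmatrix A = map_matrix complex_of_real A"

definition eigenvalues :: "complex ^ 'n ^ 'n \<Rightarrow> complex set" where
  "eigenvalues A = {\<mu>. \<exists>u. u \<noteq> 0 \<and> A *v u = \<mu> *s u}"

definition charpoly :: "complex ^ 'n ^ 'n \<Rightarrow> complex poly" where
  "charpoly A = det (mat [:0, 1:] - map_matrix (\<lambda>a. [:a:]) A)"

definition simple_eigenvalue :: "complex ^ 'n ^ 'n \<Rightarrow> complex \<Rightarrow> bool" where
  "simple_eigenvalue A \<mu> \<longleftrightarrow> \<mu> \<in> eigenvalues A \<and> order \<mu> (charpoly A) = 1"

definition diagonalizable :: "complex ^ 'n ^ 'n \<Rightarrow> bool" where
  "diagonalizable A \<longleftrightarrow>
     (\<exists>(S :: complex ^ 'n ^ 'n) (D :: complex ^ 'n ^ 'n).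
        invertible S \<and> (\<forall>i j. i \<noteq> j \<longrightarrow> D $ i $ j = 0) \<and> A = S ** D ** matrix_inv S)"

text \<open>The univariate normal law with mean \<open>m\<close> and variance \<open>s2\<close>; variance \<open>0\<close> gives the
  point mass at \<open>m\<close>.\<close>

definition normal_law :: "real \<Rightarrow> real \<Rightarrow> real measure" where
  "normal_law m s2 =
     (if s2 = 0 then return borel m else density lborel (normal_density m (sqrt s2)))"

text \<open>\<open>X\<close> has the (possibly degenerate) multivariate normal law with mean \<open>\<mu>\<close> and covariance
  matrix \<open>\<Sigma>\<close>: every linear functional of \<open>X\<close> is univariate normal with the corresponding mean
  and variance. No density is used because \<open>\<Sigma>\<close> may be singular.\<close>

definition gaussian_vector ::
    "'w measure \<Rightarrow> ('w \<Rightarrow> real ^ 'n) \<Rightarrow> real ^ 'n \<Rightarrow> real ^ 'n ^ 'n \<Rightarrow> bool" where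
  "gaussian_vector P X \<mu> \<Sigma> \<longleftrightarrow>
     prob_space P \<and> X \<in> borel_measurable P \<and>
     transpose \<Sigma> = \<Sigma> \<and> (\<forall>u. 0 \<le> u \<bullet> (\<Sigma> *v u)) \<and>
     (\<forall>u. distr P borel (\<lambda>\<omega>. u \<bullet> X \<omega>) = normal_law (u \<bullet> \<mu>) (u \<bullet> (\<Sigma> *v u)))"

text \<open>Convergence in probability along a filter, to a constant and to infinity. The probability
  space may depend on the parameter, since only the individual laws matter.\<close>

definition tendsto_in_prob ::
    "('a \<Rightarrow> 'w measure) \<Rightarrow> ('a \<Rightarrow> 'w \<Rightarrow> real) \<Rightarrow> real \<Rightarrow> 'a filter \<Rightarrow> bool" where
  "tendsto_in_prob P X c F \<longleftrightarrow>
     (\<forall>\<epsilon>>0. ((\<lambda>a. measure (P a) {\<omega>\<in>space (P a). \<bar>X a \<omega> - c\<bar> > \<epsilon>}) \<longlongrightarrow> 0) F)"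

definition tendsto_infinity_in_prob ::
    "('a \<Rightarrow> 'w measure) \<Rightarrow> ('a \<Rightarrow> 'w \<Rightarrow> real) \<Rightarrow> 'a filter \<Rightarrow> bool" where
  "tendsto_infinity_in_prob P X F \<longleftrightarrow>
     (\<forall>K. ((\<lambda>a. measure (P a) {\<omega>\<in>space (P a). X a \<omega> > K}) \<longlongrightarrow> 1) F)"

end

theory Submission
  imports Defs
begin

text \<open>Put \<open>\<Theta> = I - v w\<^sup>T\<close> and split the fluctuation as \<open>z = (w \<bullet> z) v + \<Theta> z\<close>. The amplitude
  \<open>w \<bullet> z\<close> is normal with variance \<open>w\<^sup>T B B\<^sup>T w / (2 \<lambda>\<^sub>1)\<close>, which diverges. The covariance
  \<open>Q = \<Theta> C \<Theta>\<^sup>T\<close> of the rest solves the Lyapunov equation of the deflated matrix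
  \<open>M' = M + \<delta> v w\<^sup>T\<close>, all of whose eigenvalues have real part at least \<open>\<delta>\<close>. Although the eigenbasis
  may degenerate at the critical parameter, the determinant of the Lyapunov operator \<open>M' \<otimes> I + I \<otimes> M'\<close>
  is the product of the pairwise sums of eigenvalues, hence at least \<open>(2 \<delta>)\<close> to the power \<open>N\<^sup>2\<close> in
  absolute value, and Cramer's rule bounds \<open>Q\<close>. So \<open>x / (w \<bullet> z)\<close> tends to \<open>v\<^sub>c\<close> in probability,
  and the coefficient of variation is scale invariant.\<close>

section \<open>Deflation of a diagonalizable matrix\<close>

text \<open>The Leibniz formula is built from sums, products and signs, all preserved by a ring
  homomorphism. This carries determinants from the reals to the complex numbers, where the
  diagonalization takes place.\<close>

lemma det_map_matrix:
  fixes f :: "'a::comm_ring_1 \<Rightarrow> 'b::comm_ring_1" and A :: "'a ^ 'n ^ 'n"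
  assumes add: "\<And>x y. f (x + y) = f x + f y" and mul: "\<And>x y. f (x * y) = f x * f y"
    and one: "f 1 = 1"
  shows "det (map_matrix f A) = f (det A)"
proof -
  have zero: "f 0 = 0"
    using add[of 0 0] by simp
  have neg: "f (- x) = - f x" for x
    using add[of x "- x"] zero by (simp add: eq_neg_iff_add_eq_0 add.commute)
  have sum: "f (sum g I) = (\<Sum>i\<in>I. f (g i))" for g :: "'c \<Rightarrow> 'a" and I
    by (induction I rule: infinite_finite_induct) (auto simp: add zero)
  have prod: "f (prod g I) = (\<Prod>i\<in>I. f (g i))" for g :: "'c \<Rightarrow> 'a" and I
    by (induction I rule: infinite_finite_induct) (auto simp: mul one)
  have sign: "f (of_int (sign p)) = of_int (sign p)" for p :: "'c \<Rightarrow> 'c"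
    by (auto simp: sign_def neg one)
  show ?thesis
    by (simp add: det_def sum prod mul sign)
qed

lemma det_cmatrix: "det (cmatrix A) = complex_of_real (det A)"
  unfolding cmatrix_def by (rule det_map_matrix) auto

lemma map_matrix_mult:
  fixes f :: "'a::comm_ring_1 \<Rightarrow> 'b::comm_ring_1" and A :: "'a ^ 'n ^ 'm"
    and B :: "'a ^ 'k ^ 'n"
  assumes add: "\<And>x y. f (x + y) = f x + f y" and mul: "\<And>x y. f (x * y) = f x * f y"
  shows "map_matrix f (A ** B) = map_matrix f A ** map_matrix f B"
proof -
  have zero: "f 0 = 0"
    using add[of 0 0] by simp
  have sum: "f (sum g I) = (\<Sum>i\<in>I. f (g i))" for g :: "'c \<Rightarrow> 'a" and I
    by (induction I rule: infinite_finite_induct) (auto simp: add zero)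
  show ?thesis
    by (simp add: vec_eq_iff matrix_matrix_mult_def sum mul)
qed

lemma matrix_add_rdistrib: "(A + B) ** C = A ** C + B ** C"
  by (simp add: vec_eq_iff matrix_matrix_mult_def distrib_right sum.distrib)

lemma matrix_sub_ldistrib: "A ** (B - C) = A ** B - A ** (C :: 'a::ring_1 ^ 'n ^ 'm)"
  by (simp add: vec_eq_iff matrix_matrix_mult_def right_diff_distrib sum_subtractf)

lemma matrix_sub_rdistrib: "(A - B) ** C = A ** C - B ** (C :: 'a::ring_1 ^ 'n ^ 'm)"
  by (simp add: vec_eq_iff matrix_matrix_mult_def left_diff_distrib sum_subtractf)

lemma mat_mult_eq_scale:
  fixes A :: "'a::comm_semiring_1 ^ 'n ^ 'm"
  shows "mat c ** A = (\<chi> i j. c * A $ i $ j)" "A ** mat c = (\<chi> i j. c * A $ i $ j)"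
  by (simp_all add: vec_eq_iff matrix_matrix_mult_def mat_def if_distrib if_distribR
      mult.commute cong: if_cong)

text \<open>The similarity lifts to polynomial matrices: constants embed by a ring homomorphism, and
  the scalar matrix \<open>?X\<close> commutes with the embedded \<open>S\<close>, so
  \<open>?X - ?c A\<close> is similar to \<open>?X - ?c D\<close>.\<close>

lemma charpoly_similar:
  fixes A D :: "complex ^ 'n ^ 'n"
  assumes A: "A = S ** D ** T" and ST: "S ** T = mat 1"
  shows "charpoly A = charpoly D"
proof -
  let ?c = "map_matrix (\<lambda>a. [:a:]) :: complex ^ 'n ^ 'n \<Rightarrow> complex poly ^ 'n ^ 'n"
  let ?X = "mat [:0, 1:] :: complex poly ^ 'n ^ 'n"
  have hom: "?c (P ** Q) = ?c P ** ?c Q" for P Q :: "complex ^ 'n ^ 'n"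
    by (rule map_matrix_mult) auto
  have "?c (mat 1) = mat 1"
    by (auto simp: vec_eq_iff mat_def one_pCons)
  then have one: "?c S ** ?c T = mat 1"
    by (metis hom ST)
  have "?X = ?X ** (?c S ** ?c T)"
    by (simp add: one)
  also have "\<dots> = ?c S ** ?X ** ?c T"
    by (simp add: matrix_mul_assoc mat_mult_eq_scale)
  finally have X: "?X = ?c S ** ?X ** ?c T" .
  have "?X - ?c A = ?c S ** ?X ** ?c T - ?c S ** ?c D ** ?c T"
    by (simp only: A hom X[symmetric])
  also have "\<dots> = ?c S ** (?X - ?c D) ** ?c T"
    by (simp add: matrix_sub_ldistrib matrix_sub_rdistrib)
  finally have "charpoly A = det (?c S ** ?c T) * charpoly D"
    unfolding charpoly_def by (simp add: det_mul)
  then show ?thesis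
    by (simp add: one)
qed

lemma charpoly_diagonal:
  assumes "\<And>i j. i \<noteq> j \<Longrightarrow> D $ i $ j = 0"
  shows "charpoly D = (\<Prod>i\<in>UNIV. [:- (D $ i $ i), 1:])"
  unfolding charpoly_def by (subst det_diagonal) (auto simp: mat_def assms)

text \<open>Used to contradict algebraic simplicity: a value occurring twice on the diagonal is at
  least a double root.\<close>

lemma order_prod_linear_ge_2:
  fixes d :: "'i \<Rightarrow> 'a::idom"
  assumes "finite I" "i \<in> I" "j \<in> I" "i \<noteq> j" "d i = l" "d j = l"
  shows "2 \<le> order l (\<Prod>k\<in>I. [:- d k, 1:])"
proof -
  let ?p = "\<Prod>k\<in>I. [:- d k, 1:]"
  have "?p = [:- l, 1:] * ([:- l, 1:] * (\<Prod>k\<in>I - {i} - {j}. [:- d k, 1:]))"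
    using assms by (simp add: prod.remove[of I i] prod.remove[of "I - {i}" j])
  then have "?p = [:- l, 1:] ^ 2 * (\<Prod>k\<in>I - {i} - {j}. [:- d k, 1:])"
    by (simp only: power2_eq_square mult.assoc)
  then have "[:- l, 1:] ^ 2 dvd ?p"
    by (rule dvdI)
  moreover have "?p \<noteq> 0"
    using assms(1) by simp
  ultimately show ?thesis
    using order_divides by blast
qed

lemma diagonal_mult_vec:
  fixes D :: "'a::comm_semiring_1 ^ 'n ^ 'n"
  assumes "\<And>i j. i \<noteq> j \<Longrightarrow> D $ i $ j = 0"
  shows "(D *v x) $ i = D $ i $ i * x $ i" "(x v* D) $ i = D $ i $ i * x $ i"
proof -
  have "(D *v x) $ i = (\<Sum>j\<in>UNIV. if j = i then D $ i $ i * x $ i else 0)"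
    unfolding matrix_vector_mult_def vec_lambda_beta
    by (rule sum.cong) (auto simp: assms[of i])
  then show "(D *v x) $ i = D $ i $ i * x $ i"
    by simp
  have "(x v* D) $ i = (\<Sum>j\<in>UNIV. if j = i then D $ i $ i * x $ i else 0)"
    unfolding vector_matrix_mult_def vec_lambda_beta
    by (rule sum.cong) (auto simp: assms mult.commute)
  then show "(x v* D) $ i = D $ i $ i * x $ i"
    by simp
qed

definition outer :: "'a::times ^ 'm \<Rightarrow> 'a ^ 'n \<Rightarrow> 'a ^ 'n ^ 'm" where
  "outer x y = (\<chi> i j. x $ i * y $ j)"

lemma outer_nth [simp]: "outer x y $ i $ j = x $ i * y $ j"
  by (simp add: outer_def)

lemma mult_outer_mult:
  fixes A :: "'a::comm_semiring_1 ^ 'm ^ 'k"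
  shows "A ** outer x y ** B = outer (A *v x) (y v* B)"
  by (simp add: vec_eq_iff matrix_matrix_mult_def matrix_vector_mult_def
      vector_matrix_mult_def sum_distrib_left sum_distrib_right mult_ac)
    (auto intro: sum.swap)

text \<open>In an eigenbasis the simple eigenvectors become multiples of the same coordinate vector,
  so that the rank one perturbation stays diagonal.\<close>

lemma diagonal_deflation:
  fixes A S D T :: "complex ^ 'n ^ 'n"
  assumes A: "A = S ** D ** T" and ST: "S ** T = mat 1" and TS: "T ** S = mat 1"
    and diag: "\<And>i j. i \<noteq> j \<Longrightarrow> D $ i $ j = 0"
    and order: "order l (charpoly A) = 1"
    and v: "A *v v = l *s v" and w: "w v* A = l *s w" and wv: "(\<Sum>i\<in>UNIV. w $ i * v $ i) = 1"
  obtains D' where "\<And>i j. i \<noteq> j \<Longrightarrow> D' $ i $ j = 0"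
    "A + outer (c *s v) w = S ** D' ** T"
    "\<And>i. D' $ i $ i = l + c \<or> (D' $ i $ i = D $ i $ i \<and> D $ i $ i \<noteq> l)"
proof -
  \<comment> \<open>\<open>p\<close> and \<open>q\<close> are the coordinates of the right and left
    eigenvectors in the eigenbasis, so they are eigenvectors of the diagonal matrix
    \<open>D\<close>.\<close>
  define p where "p = T *v v"
  define q where "q = w v* S"
  have "D *v p = T *v (A *v v)"
    by (simp add: p_def A matrix_vector_mul_assoc matrix_mul_assoc TS)
  then have "D *v p = l *s p"
    by (simp add: v p_def vector_scalar_commute)
  then have p: "D $ i $ i * p $ i = l * p $ i" for i
    by (metis diagonal_mult_vec(1) diag vector_smult_component)
  have "q v* D = (w v* A) v* S"
    unfolding q_def A by (simp add: vector_matrix_mul_assoc matrix_mul_assoc[symmetric] TS)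
  then have "q v* D = l *s q"
    by (simp add: w q_def scalar_vector_matrix_assoc)
  then have q: "D $ i $ i * q $ i = l * q $ i" for i
    by (metis diagonal_mult_vec(2) diag vector_smult_component)
  \<comment> \<open>The pairing does not depend on the basis, so its value 1 forces a coordinate
    \<open>k\<close> at which both \<open>p\<close> and \<open>q\<close> are nonzero.\<close>
  have "(\<Sum>i\<in>UNIV. q $ i * p $ i) = (\<Sum>i\<in>UNIV. w $ i * (S *v p) $ i)"
    unfolding q_def matrix_vector_mult_def vector_matrix_mult_def
    by (simp add: sum_distrib_left sum_distrib_right mult_ac) (rule sum.swap)
  also have "S *v p = v"
    by (simp add: p_def matrix_vector_mul_assoc ST)
  finally have qp: "(\<Sum>i\<in>UNIV. q $ i * p $ i) = 1"
    using wv by simp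
  then obtain k where "q $ k * p $ k \<noteq> 0"
    by (metis (mono_tags, lifting) sum.neutral zero_neq_one)
  then have Dk: "D $ k $ k = l"
    using p[of k] by auto
  \<comment> \<open>Since the root \<open>l\<close> has order one, it occupies a single diagonal
    position, and \<open>p\<close> and \<open>q\<close> are both supported at
    \<open>k\<close>.\<close>
  have unique: "i = k" if "D $ i $ i = l" for i
  proof (rule ccontr)
    assume "i \<noteq> k"
    then have "2 \<le> order l (\<Prod>i\<in>UNIV. [:- (D $ i $ i), 1:])"
      using that Dk by (intro order_prod_linear_ge_2[of _ i k]) auto
    then show False
      using order charpoly_similar[OF A ST] charpoly_diagonal[of D] diag by simp
  qed
  have p0: "p $ i = 0" and q0: "q $ i = 0" if "i \<noteq> k" for i
    using unique[of i] that p[of i] q[of i] by auto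
  have "(\<Sum>i\<in>UNIV. q $ i * p $ i) = (\<Sum>i\<in>UNIV. if i = k then q $ k * p $ k else 0)"
    by (rule sum.cong) (auto simp: p0)
  with qp have qpk: "q $ k * p $ k = 1"
    by simp
  \<comment> \<open>Only the entry at \<open>k\<close> changes: the added term there is
    \<open>c * p $ k * q $ k = c\<close>.\<close>
  define D' where "D' = D + outer (c *s p) q"
  show thesis
  proof
    show "D' $ i $ j = 0" if "i \<noteq> j" for i j
      using that diag p0[of i] q0[of j] by (cases "i = k") (auto simp: D'_def)
    have "S ** outer (c *s p) q ** T = outer (c *s v) w"
      unfolding mult_outer_mult
      by (simp add: p_def q_def vector_scalar_commute matrix_vector_mul_assoc
          vector_matrix_mul_assoc ST)
    then show "A + outer (c *s v) w = S ** D' ** T"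
      unfolding D'_def matrix_add_ldistrib matrix_add_rdistrib A by simp
    show "D' $ i $ i = l + c \<or> (D' $ i $ i = D $ i $ i \<and> D $ i $ i \<noteq> l)" for i
    proof (cases "i = k")
      case True
      then show ?thesis
        using qpk Dk by (simp add: D'_def mult.assoc mult.commute[of "p $ k"])
    next
      case False
      then show ?thesis
        using unique[of i] p0[of i] by (auto simp: D'_def)
    qed
  qed
qed

section \<open>The Lyapunov operator as a matrix\<close>

definition kron ::
    "'a::times ^ 'n::finite ^ 'm::finite \<Rightarrow> 'a ^ 'l::finite ^ 'k::finite \<Rightarrow> 'a ^ ('n \<times> 'l) ^ ('m \<times> 'k)" where
  "kron A B = (\<chi> a b. A $ fst a $ fst b * B $ snd a $ snd b)"

text \<open>The Kronecker sum. In the coordinates \<open>vec_of\<close> it represents the map taking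
  \<open>X\<close> to \<open>A ** X + X ** transpose A\<close>, which makes determinants and
  Cramer's rule available for the Lyapunov equation.\<close>

definition lyapunov_matrix :: "'a::comm_ring_1 ^ 'n::finite ^ 'n \<Rightarrow> 'a ^ ('n \<times> 'n) ^ ('n \<times> 'n)" where
  "lyapunov_matrix A = kron A (mat 1) + kron (mat 1) A"

definition vec_of :: "'a ^ 'n::finite ^ 'm::finite \<Rightarrow> 'a ^ ('m \<times> 'n)" where
  "vec_of X = (\<chi> a. X $ fst a $ snd a)"

lemma kron_mult:
  fixes A :: "'a::comm_ring_1 ^ 'n ^ 'm"
  shows "kron A B ** kron C D = kron (A ** C) (B ** D)"
proof -
  have "(kron A B ** kron C D) $ a $ b = kron (A ** C) (B ** D) $ a $ b" for a b
  proof -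
    have "(kron A B ** kron C D) $ a $ b
        = (\<Sum>c\<in>UNIV \<times> UNIV. case c of (x, y) \<Rightarrow>
            (A $ fst a $ x * C $ x $ fst b) * (B $ snd a $ y * D $ y $ snd b))"
      unfolding UNIV_Times_UNIV by (simp add: kron_def matrix_matrix_mult_def case_prod_beta mult_ac)
    also have "\<dots> = kron (A ** C) (B ** D) $ a $ b"
      by (simp add: kron_def matrix_matrix_mult_def sum_product sum.cartesian_product del: UNIV_Times_UNIV)
    finally show ?thesis .
  qed
  then show ?thesis
    by (simp add: vec_eq_iff)
qed

lemma kron_mat_1: "kron (mat 1) (mat 1) = (mat 1 :: 'a::comm_ring_1 ^ ('n::finite \<times> 'm::finite) ^ ('n \<times> 'm))"
  by (auto simp: kron_def mat_def vec_eq_iff prod_eq_iff)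

lemma lyapunov_matrix_mult_vec_of:
  "lyapunov_matrix A *v vec_of X = vec_of (A ** X + X ** transpose A)"
proof -
  have "(lyapunov_matrix A *v vec_of X) $ a = vec_of (A ** X + X ** transpose A) $ a" for a
  proof -
    have "(lyapunov_matrix A *v vec_of X) $ a
      = (\<Sum>b\<in>UNIV \<times> UNIV. case b of (x, y) \<Rightarrow>
         (if snd a = y then A $ fst a $ x * X $ x $ y else 0)
         + (if fst a = x then A $ snd a $ y * X $ x $ y else 0))"
      unfolding UNIV_Times_UNIV lyapunov_matrix_def kron_def vec_of_def matrix_vector_mult_def mat_def
      by (auto simp: case_prod_beta distrib_right intro!: sum.cong)
    also have "\<dots> = (\<Sum>x\<in>UNIV. A $ fst a $ x * X $ x $ snd a)
        + (\<Sum>x\<in>UNIV. if fst a = x then \<Sum>y\<in>UNIV. A $ snd a $ y * X $ x $ y else 0)"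
      unfolding sum.cartesian_product[symmetric] by (simp add: sum.distrib)
        (subst sum.swap, simp)
    also have "\<dots> = vec_of (A ** X + X ** transpose A) $ a"
      by (simp add: vec_of_def matrix_matrix_mult_def transpose_def mult.commute)
    finally show ?thesis .
  qed
  then show ?thesis
    by (simp add: vec_eq_iff)
qed

text \<open>\<open>kron S S\<close> diagonalizes the Kronecker sum along with \<open>A\<close>,
  because \<open>S ** T = mat 1\<close> restores the identity factors. The diagonal then consists of
  all pairwise sums of entries of \<open>D\<close>.\<close>

lemma det_lyapunov_matrix:
  fixes A S D T :: "'a::comm_ring_1 ^ 'n ^ 'n"
  assumes A: "A = S ** D ** T" and ST: "S ** T = mat 1"
    and diag: "\<And>i j. i \<noteq> j \<Longrightarrow> D $ i $ j = 0"
  shows "det (lyapunov_matrix A) = (\<Prod>a\<in>UNIV. D $ fst a $ fst a + D $ snd a $ snd a)"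
proof -
  have "lyapunov_matrix A = kron S S ** lyapunov_matrix D ** kron T T"
    unfolding lyapunov_matrix_def
    by (simp add: matrix_add_ldistrib matrix_add_rdistrib kron_mult A ST)
  then have "det (lyapunov_matrix A) = det (kron S S ** kron T T) * det (lyapunov_matrix D)"
    by (simp only: det_mul mult_ac)
  also have "det (kron S S ** kron T T) = 1"
    by (simp add: kron_mult ST kron_mat_1)
  also have "det (lyapunov_matrix D) = (\<Prod>a\<in>UNIV. D $ fst a $ fst a + D $ snd a $ snd a)"
    by (subst det_diagonal)
      (auto simp: lyapunov_matrix_def kron_def mat_def diag prod_eq_iff)
  finally show ?thesis
    by simp
qed

lemma cmatrix_lyapunov_matrix: "cmatrix (lyapunov_matrix A) = lyapunov_matrix (cmatrix A)"
  by (auto simp: lyapunov_matrix_def kron_def cmatrix_def mat_def vec_eq_iff)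

text \<open>The rank one term moves \<open>l\<close> to \<open>l + \<delta>\<close> and keeps the
  rest of the spectrum, so every factor of the determinant has real part at least
  \<open>2 * \<delta>\<close>. The bound does not involve the diagonalizing matrix, whose
  conditioning is uncontrolled.\<close>

lemma abs_det_lyapunov_matrix_ge:
  fixes A :: "real ^ 'n ^ 'n"
  assumes diag: "diagonalizable (cmatrix A)"
    and simple: "simple_eigenvalue (cmatrix A) (complex_of_real l)"
    and l: "l \<ge> 0" and \<delta>: "\<delta> > 0"
    and gap: "\<And>\<mu>. \<mu> \<in> eigenvalues (cmatrix A) - {complex_of_real l} \<Longrightarrow> Re \<mu> \<ge> \<delta>"
    and v: "A *v v = l *\<^sub>R v" and w: "w v* A = l *\<^sub>R w" and wv: "w \<bullet> v = 1"
  shows "\<bar>det (lyapunov_matrix (A + outer (\<delta> *\<^sub>R v) w))\<bar> \<ge> (2 * \<delta>) ^ CARD('n \<times> 'n)"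
proof -
  obtain S D :: "complex ^ 'n ^ 'n" where inv: "invertible S" and D: "\<And>i j. i \<noteq> j \<Longrightarrow> D $ i $ j = 0"
    and A: "cmatrix A = S ** D ** matrix_inv S"
    using diag unfolding diagonalizable_def by blast
  define T where "T = matrix_inv S"
  have ST: "S ** T = mat 1" and TS: "T ** S = mat 1"
    using someI_ex[OF inv[unfolded invertible_def]] by (simp_all add: T_def matrix_inv_def)
  have order: "order (complex_of_real l) (charpoly (cmatrix A)) = 1"
    using simple by (simp add: simple_eigenvalue_def)
  let ?c = "\<lambda>x :: real ^ 'n. \<chi> i. complex_of_real (x $ i)"
  have cv: "cmatrix A *v ?c v = complex_of_real l *s ?c v"
    using arg_cong[OF v, of ?c]
    by (simp add: vec_eq_iff cmatrix_def matrix_vector_mult_def flip: of_real_mult of_real_sum)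
  have cw: "?c w v* cmatrix A = complex_of_real l *s ?c w"
    using arg_cong[OF w, of ?c]
    by (simp add: vec_eq_iff cmatrix_def vector_matrix_mult_def flip: of_real_mult of_real_sum)
  have cwv: "(\<Sum>i\<in>UNIV. ?c w $ i * ?c v $ i) = 1"
    using wv by (simp add: inner_vec_def flip: of_real_mult of_real_sum)
  obtain D' where D': "\<And>i j. i \<noteq> j \<Longrightarrow> D' $ i $ j = 0"
    "cmatrix A + outer (complex_of_real \<delta> *s ?c v) (?c w) = S ** D' ** T"
    "\<And>i. D' $ i $ i = of_real l + of_real \<delta> \<or> (D' $ i $ i = D $ i $ i \<and> D $ i $ i \<noteq> of_real l)"
    by (rule diagonal_deflation[OF A[folded T_def] ST TS D order cv cw cwv,
          where c = "complex_of_real \<delta>"]) blast+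
  \<comment> \<open>The gap hypothesis speaks of eigenvalues, so each diagonal entry is exhibited as
    one; its eigenvector is column \<open>i\<close> of \<open>S\<close>.\<close>
  have eig: "D $ i $ i \<in> eigenvalues (cmatrix A)" for i
  proof -
    let ?e = "axis i 1 :: complex ^ 'n"
    have "D *v ?e = D $ i $ i *s ?e"
      using diagonal_mult_vec(1)[OF D] by (auto simp: vec_eq_iff axis_def)
    then have "cmatrix A *v (S *v ?e) = D $ i $ i *s (S *v ?e)"
      unfolding A T_def[symmetric]
      by (simp add: matrix_vector_mul_assoc matrix_mul_assoc[symmetric] TS)
        (simp add: matrix_vector_mul_assoc[symmetric] vector_scalar_commute)
    moreover have "S *v ?e \<noteq> 0"
    proof
      assume "S *v ?e = 0"
      then have "T *v (S *v ?e) = 0"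
        by simp
      then show False
        by (simp add: matrix_vector_mul_assoc TS axis_eq_0_iff)
    qed
    ultimately show ?thesis
      by (auto simp: eigenvalues_def)
  qed
  \<comment> \<open>The moved entry has real part \<open>l + \<delta>\<close>; any other entry is an
    eigenvalue different from \<open>l\<close>, to which the gap applies.\<close>
  have Re: "Re (D' $ i $ i) \<ge> \<delta>" for i
    using D'(3)[of i] eig[of i] gap[of "D $ i $ i"] l by auto
  have "cmatrix (A + outer (\<delta> *\<^sub>R v) w) = S ** D' ** T"
    unfolding D'(2)[symmetric] by (simp add: cmatrix_def vec_eq_iff)
  then have "complex_of_real (det (lyapunov_matrix (A + outer (\<delta> *\<^sub>R v) w)))
      = (\<Prod>a\<in>UNIV. D' $ fst a $ fst a + D' $ snd a $ snd a)"
    using det_lyapunov_matrix[OF _ ST D'(1)]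
    by (simp flip: det_cmatrix add: cmatrix_lyapunov_matrix)
  from arg_cong[OF this, of cmod]
  have "\<bar>det (lyapunov_matrix (A + outer (\<delta> *\<^sub>R v) w))\<bar>
      = (\<Prod>a\<in>UNIV. cmod (D' $ fst a $ fst a + D' $ snd a $ snd a))"
    by (simp only: norm_of_real prod_norm)
  also have "\<dots> \<ge> (\<Prod>a\<in>(UNIV :: ('n \<times> 'n) set). 2 * \<delta>)"
  proof (rule prod_mono, safe)
    fix i j :: 'n
    show "0 \<le> 2 * \<delta>" using \<delta> by simp
    \<comment> \<open>Real parts add, whereas lower bounds on the moduli alone would not exclude
      cancellation.\<close>
    show "2 * \<delta> \<le> cmod (D' $ fst (i, j) $ fst (i, j) + D' $ snd (i, j) $ snd (i, j))"
      using Re[of i] Re[of j] complex_Re_le_cmod[of "D' $ i $ i + D' $ j $ j"] by simp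
  qed
  finally show ?thesis
    by simp
qed

lemma tendsto_det:
  fixes A :: "'a \<Rightarrow> real ^ 'k ^ 'k"
  assumes "(A \<longlongrightarrow> A\<^sub>0) F"
  shows "((\<lambda>x. det (A x)) \<longlongrightarrow> det A\<^sub>0) F"
  unfolding det_def
  by (intro tendsto_sum tendsto_mult tendsto_const tendsto_prod tendsto_vec_nth assms)

text \<open>By Cramer's rule the component is a quotient of determinants. The numerator converges
  with the data and is eventually bounded, while the denominator stays at least \<open>m\<close> in
  absolute value.\<close>

lemma linear_system_solution_bounded:
  fixes A :: "'a \<Rightarrow> real ^ 'k ^ 'k"
  assumes A: "(A \<longlongrightarrow> A\<^sub>0) F" and b: "(b \<longlongrightarrow> b\<^sub>0) F"
    and m: "m > 0" "\<forall>\<^sub>F x in F. \<bar>det (A x)\<bar> \<ge> m"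
    and sol: "\<forall>\<^sub>F x in F. A x *v y x = b x"
  obtains R where "\<forall>\<^sub>F x in F. \<bar>y x $ k\<bar> \<le> R"
proof -
  define B where "B x = (\<chi> i j. if j = k then b x $ i else A x $ i $ j)" for x
  define B\<^sub>0 where "B\<^sub>0 = (\<chi> i j. if j = k then b\<^sub>0 $ i else A\<^sub>0 $ i $ j)"
  have "(B \<longlongrightarrow> B\<^sub>0) F"
    unfolding B_def B\<^sub>0_def by (intro vec_tendstoI) (auto intro!: tendsto_intros A b)
  then have "((\<lambda>x. \<bar>det (B x)\<bar>) \<longlongrightarrow> \<bar>det B\<^sub>0\<bar>) F"
    by (intro tendsto_rabs tendsto_det)
  then have "\<forall>\<^sub>F x in F. \<bar>det (B x)\<bar> < \<bar>det B\<^sub>0\<bar> + 1"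
    by (rule order_tendstoD) simp
  with m(2) sol have "\<forall>\<^sub>F x in F. \<bar>y x $ k\<bar> \<le> (\<bar>det B\<^sub>0\<bar> + 1) / m"
  proof eventually_elim
    case (elim x)
    have "det (A x) \<noteq> 0"
      using elim m(1) by auto
    then have "y x $ k = det (B x) / det (A x)"
      using elim(2) cramer[of "A x" "y x" "b x"] by (simp add: B_def)
    then have "\<bar>y x $ k\<bar> = \<bar>det (B x)\<bar> / \<bar>det (A x)\<bar>"
      by simp
    also have "\<dots> \<le> (\<bar>det B\<^sub>0\<bar> + 1) / m"
      using elim m(1) by (intro frac_le) auto
    finally show ?case .
  qed
  then show thesis
    by (rule that)
qed

section \<open>Concentration of centred normal laws\<close>

text \<open>The density never exceeds its peak \<open>1 / sqrt (2 * pi * s)\<close>, and the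
  interval has length \<open>2 * T\<close>. A fixed interval thus loses its mass as the variance
  grows.\<close>

lemma normal_law_anticoncentration:
  assumes X: "X \<in> borel_measurable P" and law: "distr P borel X = normal_law 0 s"
    and s: "s > 0" and T: "T \<ge> 0"
  shows "measure P {\<omega>\<in>space P. \<bar>X \<omega>\<bar> \<le> T} \<le> 2 * T / sqrt (2 * pi * s)"
proof -
  let ?c = "1 / sqrt (2 * pi * s)"
  have "{\<omega>\<in>space P. \<bar>X \<omega>\<bar> \<le> T} = X -` {-T..T} \<inter> space P"
    by (auto simp: abs_le_iff)
  then have "emeasure P {\<omega>\<in>space P. \<bar>X \<omega>\<bar> \<le> T} = emeasure (distr P borel X) {-T..T}"
    using X by (simp add: emeasure_distr)
  also have "\<dots> = (\<integral>\<^sup>+x. ennreal (normal_density 0 (sqrt s) x) * indicator {-T..T} x \<partial>lborel)"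
    using s by (simp add: law normal_law_def emeasure_density)
  also have "\<dots> \<le> (\<integral>\<^sup>+x. ennreal ?c * indicator {-T..T} x \<partial>lborel)"
  proof (intro nn_integral_mono mult_right_mono ennreal_leI)
    fix x :: real
    have "exp (- x\<^sup>2 / (2 * s)) \<le> 1"
      using s by simp
    then have "?c * exp (- x\<^sup>2 / (2 * s)) \<le> ?c * 1"
      using s by (intro mult_left_mono) auto
    then show "normal_density 0 (sqrt s) x \<le> ?c"
      using s by (simp add: normal_density_def)
  qed auto
  also have "\<dots> = ennreal ?c * ennreal (2 * T)"
    using T by (simp add: nn_integral_cmult)
  also have "\<dots> = ennreal (2 * T / sqrt (2 * pi * s))"
    using T s by (simp flip: ennreal_mult)
  finally show ?thesis
    using T s by (auto simp: measure_def intro!: enn2real_leI)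
qed

text \<open>The point mass at variance \<open>0\<close> is included because a covariance matrix may
  be singular in some directions.\<close>

lemma normal_law_second_moment:
  assumes "s \<ge> 0"
  shows "prob_space (normal_law 0 s)" "integrable (normal_law 0 s) (\<lambda>x. x\<^sup>2)"
    "(\<integral>x. x\<^sup>2 \<partial>normal_law 0 s) = s"
proof -
  have "prob_space (normal_law 0 s) \<and> integrable (normal_law 0 s) (\<lambda>x. x\<^sup>2) \<and>
    (\<integral>x. x\<^sup>2 \<partial>normal_law 0 s) = s"
  proof (cases "s = 0")
    case True
    have "integrable (return borel (0::real)) (\<lambda>x. x\<^sup>2)"
      by (rule integrableI_bounded) (auto simp: nn_integral_return)
    with True show ?thesis
      by (simp add: normal_law_def prob_space_return integral_return)
  next
    case False
    with assms have s: "s > 0"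
      by simp
    have "has_bochner_integral lborel (\<lambda>x. normal_density 0 (sqrt s) x * x\<^sup>2) s"
      using normal_moment_even[of "sqrt s" 0 1] s by (simp add: fact_numeral numeral_2_eq_2)
    with s show ?thesis
      by (simp add: normal_law_def prob_space_normal_density integrable_density integral_density
          has_bochner_integral_iff)
  qed
  then show "prob_space (normal_law 0 s)" "integrable (normal_law 0 s) (\<lambda>x. x\<^sup>2)"
    "(\<integral>x. x\<^sup>2 \<partial>normal_law 0 s) = s"
    by auto
qed

text \<open>Chebyshev's inequality, applied to the law on the real line after transporting the event
  along \<open>X\<close>.\<close>

lemma normal_law_tail:
  assumes X: "X \<in> borel_measurable P" and law: "distr P borel X = normal_law 0 s"
    and s: "s \<ge> 0" and L: "L > 0"
  shows "measure P {\<omega>\<in>space P. L \<le> \<bar>X \<omega>\<bar>} \<le> s / L\<^sup>2"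
proof -
  interpret N: prob_space "normal_law 0 s"
    by (rule normal_law_second_moment(1)[OF s])
  have sets: "sets (normal_law 0 s) = sets borel" and space: "space (normal_law 0 s) = UNIV"
    by (simp_all add: normal_law_def)
  have "{\<omega>\<in>space P. L \<le> \<bar>X \<omega>\<bar>} = X -` {x. L \<le> \<bar>x\<bar>} \<inter> space P"
    by auto
  then have "measure P {\<omega>\<in>space P. L \<le> \<bar>X \<omega>\<bar>} = measure (normal_law 0 s) {x. L \<le> \<bar>x\<bar>}"
    using X by (simp add: measure_distr flip: law)
  also have "\<dots> \<le> (\<integral>x. x\<^sup>2 \<partial>normal_law 0 s) / L\<^sup>2"
    using N.second_moment_method[of "\<lambda>x. x" L] normal_law_second_moment[OF s] L
    by (simp add: space measurable_def sets)
  finally show ?thesis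
    by (simp add: normal_law_second_moment[OF s])
qed

section \<open>The coefficient of variation\<close>

lemma vmean_scaleR: "vmean (c *\<^sub>R x) = c * vmean x"
  by (simp add: vmean_def sum_distrib_left)

lemma vvar_scaleR: "vvar (c *\<^sub>R x) = c\<^sup>2 * vvar x"
proof -
  have "(c *\<^sub>R x) $ i - vmean (c *\<^sub>R x) = c * (x $ i - vmean x)" for i
    by (simp add: vmean_scaleR right_diff_distrib)
  then show ?thesis
    by (simp add: vvar_def power_mult_distrib sum_distrib_left)
qed

text \<open>The absolute value in the denominator cancels the sign of \<open>c\<close> as well as
  its size. This permits division by a random amplitude of either sign.\<close>

lemma cv_scaleR: "c \<noteq> 0 \<Longrightarrow> cv (c *\<^sub>R x) = cv x"
  by (simp add: cv_def vmean_scaleR vvar_scaleR real_sqrt_mult abs_mult)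

lemma isCont_vmean: "isCont vmean x"
  unfolding vmean_def by (intro continuous_intros) auto

lemma isCont_vvar:
  fixes x :: "real ^ 'n"
  assumes "CARD('n) \<ge> 2"
  shows "isCont vvar x"
  unfolding vvar_def using assms by (intro continuous_intros isCont_vmean) auto

lemma borel_measurable_cv:
  fixes X :: "'w \<Rightarrow> real ^ 'n"
  assumes N: "CARD('n) \<ge> 2" and X: "X \<in> borel_measurable P"
  shows "(\<lambda>\<omega>. cv (X \<omega>)) \<in> borel_measurable P"
proof -
  have vmean: "(vmean :: real ^ 'n \<Rightarrow> real) \<in> borel_measurable borel"
    by (intro borel_measurable_continuous_onI continuous_at_imp_continuous_on ballI isCont_vmean)
  have vvar: "(vvar :: real ^ 'n \<Rightarrow> real) \<in> borel_measurable borel"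
    by (intro borel_measurable_continuous_onI continuous_at_imp_continuous_on ballI isCont_vvar N)
  note [measurable] = vmean vvar X
  show ?thesis
    unfolding cv_def by measurable
qed

lemma vmean_eq_inner: "vmean (u :: real ^ 'n) = ((1 :: real ^ 'n) \<bullet> u) / real CARD('n)"
  by (simp add: vmean_def inner_vec_def)

text \<open>In this form the variance of a unit vector depends only on its inner product with the
  all-ones vector.\<close>

lemma vvar_eq: "vvar (u :: real ^ 'n)
    = ((norm u)\<^sup>2 - ((1 :: real ^ 'n) \<bullet> u)\<^sup>2 / real CARD('n)) / (real CARD('n) - 1)"
proof -
  let ?N = "real CARD('n)" and ?S = "\<Sum>i\<in>UNIV. u $ i"
  have S: "?S = ?N * vmean u"
    by (simp add: vmean_def)
  have "(\<Sum>i\<in>UNIV. (u $ i - vmean u)\<^sup>2)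
      = (\<Sum>i\<in>UNIV. (u $ i)\<^sup>2) - 2 * vmean u * ?S + ?N * (vmean u)\<^sup>2"
    by (simp add: power2_diff sum.distrib sum_subtractf sum_distrib_left mult_ac)
  also have "(\<Sum>i\<in>UNIV. (u $ i)\<^sup>2) = (norm u)\<^sup>2"
    by (simp add: norm_vec_def L2_set_def sum_nonneg)
  also have "(norm u)\<^sup>2 - 2 * vmean u * ?S + ?N * (vmean u)\<^sup>2 = (norm u)\<^sup>2 - ?S\<^sup>2 / ?N"
    unfolding S by (simp add: power2_eq_square)
  finally show ?thesis
    by (simp add: vvar_def inner_vec_def)
qed

lemma inner_one_squared_le:
  assumes "norm (u :: real ^ 'n) = 1"
  shows "((1 :: real ^ 'n) \<bullet> u)\<^sup>2 \<le> real CARD('n)"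
proof -
  have "((1 :: real ^ 'n) \<bullet> u)\<^sup>2 \<le> ((1 :: real ^ 'n) \<bullet> 1) * (u \<bullet> u)"
    by (rule Cauchy_Schwarz_ineq)
  also have "\<dots> = real CARD('n)"
    using assms by (simp flip: power2_norm_eq_inner) (simp add: power2_norm_eq_inner inner_vec_def)
  finally show ?thesis .
qed

text \<open>At \<open>\<rho> = 1\<close> the value is \<open>0\<close>, so one formula serves both
  finite limits. At \<open>\<rho> = 0\<close> both sides are \<open>0\<close> by total division, and
  the value says nothing about nearby vectors.\<close>

lemma cv_unit_vector:
  fixes u :: "real ^ 'n"
  assumes "norm u = 1"
  defines "N \<equiv> real CARD('n)"
  defines "\<rho> \<equiv> ((1 :: real ^ 'n) \<bullet> u)\<^sup>2 / N"
  shows "cv u = sqrt (N * (1 - \<rho>) / ((N - 1) * \<rho>))"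
proof -
  have N: "N > 0"
    by (simp add: N_def)
  have \<rho>: "\<rho> / N = (vmean u)\<^sup>2"
    using N by (simp add: \<rho>_def vmean_eq_inner N_def power_divide power2_eq_square)
  have "\<bar>vmean u\<bar> = sqrt (\<rho> / N)"
    unfolding \<rho> by simp
  moreover have "vvar u = (1 - \<rho>) / (N - 1)"
    by (simp add: vvar_eq assms)
  ultimately have "cv u = sqrt ((1 - \<rho>) / (N - 1) / (\<rho> / N))"
    by (simp only: cv_def real_sqrt_divide)
  also have "(1 - \<rho>) / (N - 1) / (\<rho> / N) = N * (1 - \<rho>) / ((N - 1) * \<rho>)"
    by simp
  finally show ?thesis .
qed

section \<open>Concentration of the direction of a Gaussian vector\<close>

lemma tendsto_zero_if_eventually_less:
  fixes f :: "'a \<Rightarrow> real"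
  assumes "\<And>a. f a \<ge> 0" and "\<And>e. e > 0 \<Longrightarrow> \<forall>\<^sub>F a in F. f a < e"
  shows "(f \<longlongrightarrow> 0) F"
  using assms by (intro tendstoI) (simp add: dist_real_def)

text \<open>The vector is \<open>x a + z a \<omega> = s v + (x a + (z a \<omega> - s v))\<close> with \<open>s = w \<bullet> z a \<omega>\<close>. The
  amplitude \<open>s\<close> diverges while the rest is tight. If \<open>s = 0\<close>, the rescaled vector is \<open>0\<close>.\<close>

lemma gaussian_direction_concentrates:
  fixes z :: "'a \<Rightarrow> 'w \<Rightarrow> real ^ 'n" and v w x :: "'a \<Rightarrow> real ^ 'n" and q :: "'a \<Rightarrow> 'n \<Rightarrow> real ^ 'n"
  assumes gauss: "\<forall>\<^sub>F a in F. gaussian_vector (P a) (z a) 0 (C a)"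
    and v: "(v \<longlongrightarrow> v\<^sub>0) F" and x: "(x \<longlongrightarrow> x\<^sub>0) F"
    and amplitude: "filterlim (\<lambda>a. w a \<bullet> (C a *v w a)) at_top F"
    and q: "\<And>a i y. q a i \<bullet> y = (y - (w a \<bullet> y) *\<^sub>R v a) $ i"
    and tight: "\<And>i. \<exists>R. \<forall>\<^sub>F a in F. q a i \<bullet> (C a *v q a i) \<le> R"
    and \<eta>: "\<eta> > 0"
  shows "((\<lambda>a. measure (P a) {\<omega>\<in>space (P a).
      \<eta> \<le> dist ((1 / (w a \<bullet> z a \<omega>)) *\<^sub>R (x a + z a \<omega>)) v\<^sub>0}) \<longlongrightarrow> 0) F"
proof (rule tendsto_zero_if_eventually_less)
  fix e :: real
  assume e: "e > 0"
  define n where "n = real CARD('n)"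
  have n: "n > 0"
    by (simp add: n_def)
  obtain R' where "\<forall>\<^sub>F a in F. q a i \<bullet> (C a *v q a i) \<le> R' i" for i
    using tight by metis
  then have R': "\<forall>\<^sub>F a in F. \<forall>i. q a i \<bullet> (C a *v q a i) \<le> R' i"
    by (simp add: eventually_all_finite)
  \<comment> \<open>One positive bound for all residual variances, available because there are
    finitely many coordinates.\<close>
  define R where "R = (\<Sum>i\<in>UNIV. \<bar>R' i\<bar>) + 1"
  have R: "R > 0"
    by (simp add: R_def add_nonneg_pos sum_nonneg)
  have R'_le: "R' i \<le> R" for i
    using member_le_sum[of i UNIV "\<lambda>i. \<bar>R' i\<bar>"] by (simp add: R_def)
  \<comment> \<open>\<open>L\<close> makes Chebyshev's bound \<open>R / L\<^sup>2\<close>, summed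
    over the \<open>n\<close> coordinates, smaller than \<open>e / 2\<close>.\<close>
  define L where "L = sqrt (2 * n * R / e) + 1"
  have L: "L > 0"
    using n R e by (simp add: L_def add_nonneg_pos)
  have "2 * n * R / e < L\<^sup>2"
    using n R e by (simp add: L_def power2_sum add_nonneg_pos)
  then have nRL: "n * (R / L\<^sup>2) < e / 2"
    using e L by (simp add: field_simps)
  define B where "B = norm x\<^sub>0 + 1"
  \<comment> \<open>\<open>T\<close> is chosen so that \<open>(B + n * L) / T\<close> equals
    \<open>\<eta> / 2\<close>.\<close>
  define T where "T = 2 * (B + n * L) / \<eta>"
  have BL: "B + n * L > 0"
    using n L by (simp add: B_def add_nonneg_pos)
  then have T: "T > 0"
    using \<eta> by (simp add: T_def)
  \<comment> \<open>Above this variance the amplitude lies within \<open>T\<close> of zero with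
    probability below \<open>e / 2\<close>. The maximum with \<open>0\<close> supplies the
    positivity that anticoncentration requires.\<close>
  have "\<forall>\<^sub>F a in F. w a \<bullet> (C a *v w a) > max 0 ((4 * T / e)\<^sup>2 / (2 * pi))"
    using amplitude by (simp add: filterlim_at_top_dense)
  moreover have "\<forall>\<^sub>F a in F. norm (x a) < B"
    using tendsto_norm[OF x] by (rule order_tendstoD) (simp add: B_def)
  moreover have "\<forall>\<^sub>F a in F. dist (v a) v\<^sub>0 < \<eta> / 2"
    using \<eta> by (intro tendstoD[OF v]) simp
  ultimately show "\<forall>\<^sub>F a in F. measure (P a) {\<omega>\<in>space (P a).
      \<eta> \<le> dist ((1 / (w a \<bullet> z a \<omega>)) *\<^sub>R (x a + z a \<omega>)) v\<^sub>0} < e"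
    using gauss R'
  proof eventually_elim
    case (elim a)
    then interpret prob_space "P a"
      by (simp add: gaussian_vector_def)
    have [measurable]: "z a \<in> borel_measurable (P a)"
      and nonneg: "0 \<le> u \<bullet> (C a *v u)"
      and law: "distr (P a) borel (\<lambda>\<omega>. u \<bullet> z a \<omega>) = normal_law 0 (u \<bullet> (C a *v u))" for u
      using elim by (simp_all add: gaussian_vector_def)
    let ?\<kappa> = "w a \<bullet> (C a *v w a)"
    let ?A = "{\<omega>\<in>space (P a). \<bar>w a \<bullet> z a \<omega>\<bar> \<le> T}"
    let ?B = "\<lambda>i. {\<omega>\<in>space (P a). L \<le> \<bar>q a i \<bullet> z a \<omega>\<bar>}"
    have \<kappa>: "?\<kappa> > 0" "(4 * T / e)\<^sup>2 / (2 * pi) < ?\<kappa>"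
      using elim by (simp_all only: max_less_iff_conj)
    have two_pi: "2 * pi > 0"
      by simp
    have A: "prob ?A < e / 2"
    proof -
      have "4 * T / e < sqrt (2 * pi * ?\<kappa>)"
        using \<kappa>(2) pos_divide_less_eq[OF two_pi, of "(4 * T / e)\<^sup>2" ?\<kappa>]
        by (intro real_less_rsqrt) (metis mult.commute)
      then have "2 * T / sqrt (2 * pi * ?\<kappa>) < e / 2"
        using e T \<kappa> by (simp add: field_simps)
      then show ?thesis
        using normal_law_anticoncentration[OF _ law[of "w a"] \<kappa>(1), of T] T by simp
    qed
    have B: "prob (?B i) \<le> R / L\<^sup>2" for i
    proof -
      have "prob (?B i) \<le> (q a i \<bullet> (C a *v q a i)) / L\<^sup>2"
        using normal_law_tail[OF _ law nonneg L] by simp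
      also have "\<dots> \<le> R / L\<^sup>2"
        using elim R'_le[of i] by (intro divide_right_mono) (auto intro: order_trans)
      finally show ?thesis .
    qed
    \<comment> \<open>Off these events the amplitude exceeds \<open>T\<close> and every residual
      coordinate is below \<open>L\<close>. The error splits into \<open>v a - v\<^sub>0\<close> and
      the rescaled rest, with a budget of \<open>\<eta> / 2\<close> for each.\<close>
    have "{\<omega>\<in>space (P a). \<eta> \<le> dist ((1 / (w a \<bullet> z a \<omega>)) *\<^sub>R (x a + z a \<omega>)) v\<^sub>0}
        \<subseteq> ?A \<union> (\<Union>i\<in>UNIV. ?B i)"
    proof (rule ccontr)
      assume "\<not> ?thesis"
      then obtain \<omega> where "\<omega> \<in> space (P a)" "\<omega> \<notin> ?A" "\<And>i. \<omega> \<notin> ?B i"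
        and far: "\<eta> \<le> dist ((1 / (w a \<bullet> z a \<omega>)) *\<^sub>R (x a + z a \<omega>)) v\<^sub>0"
        by blast
      then have s: "T < \<bar>w a \<bullet> z a \<omega>\<bar>" and rest: "\<And>i. \<bar>q a i \<bullet> z a \<omega>\<bar> < L"
        by (auto simp: not_le)
      define s where "s = w a \<bullet> z a \<omega>"
      define y where "y = z a \<omega> - s *\<^sub>R v a"
      have "norm y \<le> (\<Sum>i\<in>UNIV. \<bar>y $ i\<bar>)"
        by (rule norm_le_l1_cart)
      also have "\<dots> \<le> (\<Sum>i\<in>(UNIV :: 'n set). L)"
        using rest by (intro sum_mono) (simp add: q y_def s_def less_imp_le)
      finally have y: "norm y \<le> n * L"
        by (simp add: n_def)
      have s0: "s \<noteq> 0" "T < \<bar>s\<bar>"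
        using s T by (auto simp: s_def)
      have "(1 / s) *\<^sub>R (x a + z a \<omega>) - v\<^sub>0 = (v a - v\<^sub>0) + (1 / s) *\<^sub>R (x a + y)"
        using s0 by (simp add: y_def algebra_simps)
      then have "dist ((1 / s) *\<^sub>R (x a + z a \<omega>)) v\<^sub>0 \<le> dist (v a) v\<^sub>0 + norm ((1 / s) *\<^sub>R (x a + y))"
        unfolding dist_norm by (metis norm_triangle_ineq)
      also have "norm ((1 / s) *\<^sub>R (x a + y)) = norm (x a + y) / \<bar>s\<bar>"
        by simp
      also have "\<dots> \<le> (B + n * L) / T"
        using elim y s0 T BL by (intro frac_le) (auto intro: order_trans[OF norm_triangle_ineq])
      also have "\<dots> = \<eta> / 2"
        using T \<eta> BL by (simp add: T_def divide_eq_eq algebra_simps)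
      finally show False
        using far elim by (simp add: s_def)
    qed
    then have "prob {\<omega>\<in>space (P a). \<eta> \<le> dist ((1 / (w a \<bullet> z a \<omega>)) *\<^sub>R (x a + z a \<omega>)) v\<^sub>0}
        \<le> prob (?A \<union> (\<Union>i\<in>UNIV. ?B i))"
      by (intro finite_measure_mono) auto
    also have "\<dots> \<le> prob ?A + prob (\<Union>i\<in>UNIV. ?B i)"
      by (intro measure_Un_le) auto
    also have "prob (\<Union>i\<in>UNIV. ?B i) \<le> (\<Sum>i\<in>UNIV. prob (?B i))"
      by (intro measure_UNION_le) auto
    also have "\<dots> \<le> (\<Sum>i\<in>(UNIV :: 'n set). R / L\<^sup>2)"
      by (intro sum_mono B)
    also have "\<dots> = n * (R / L\<^sup>2)"
      by (simp add: n_def)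
    finally show ?case
      using A nRL by linarith
  qed
qed simp

text \<open>A continuous mapping argument: \<open>cv\<close> is continuous at
  \<open>v\<^sub>0\<close> because the mean there is nonzero, and scale invariance passes from the
  rescaled vector to \<open>X\<close> itself.\<close>

lemma cv_tendsto_in_prob:
  fixes X :: "'a \<Rightarrow> 'w \<Rightarrow> real ^ 'n" and v\<^sub>0 :: "real ^ 'n" and s :: "'a \<Rightarrow> 'w \<Rightarrow> real"
  assumes N: "CARD('n) \<ge> 2"
    and prob: "\<forall>\<^sub>F a in F. prob_space (P a) \<and> X a \<in> borel_measurable (P a) \<and>
      s a \<in> borel_measurable (P a)"
    and conc: "\<And>\<eta>. \<eta> > 0 \<Longrightarrow>
      ((\<lambda>a. measure (P a) {\<omega>\<in>space (P a). \<eta> \<le> dist ((1 / s a \<omega>) *\<^sub>R X a \<omega>) v\<^sub>0}) \<longlongrightarrow> 0) F"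
    and v: "v\<^sub>0 \<noteq> 0" and mean: "vmean v\<^sub>0 \<noteq> 0"
  shows "tendsto_in_prob P (\<lambda>a \<omega>. cv (X a \<omega>)) (cv v\<^sub>0) F"
  unfolding tendsto_in_prob_def
proof (intro allI impI)
  fix \<epsilon> :: real
  assume \<epsilon>: "\<epsilon> > 0"
  have "isCont cv v\<^sub>0"
    unfolding cv_def using mean N by (intro continuous_intros isCont_vmean isCont_vvar) auto
  then obtain d where d: "d > 0" "\<And>u. dist u v\<^sub>0 < d \<Longrightarrow> dist (cv u) (cv v\<^sub>0) < \<epsilon>"
    using \<epsilon> unfolding continuous_at_eps_delta by (metis dist_commute)
  \<comment> \<open>The bound \<open>norm v\<^sub>0\<close> excludes
    \<open>s a \<omega> = 0\<close>: division by zero makes the rescaled vector \<open>0\<close>,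
    which is at distance \<open>norm v\<^sub>0\<close> from \<open>v\<^sub>0\<close>.\<close>
  define \<eta> where "\<eta> = min d (norm v\<^sub>0)"
  have \<eta>: "\<eta> > 0"
    using d v by (simp add: \<eta>_def)
  have "\<forall>\<^sub>F a in F. measure (P a) {\<omega>\<in>space (P a). \<bar>cv (X a \<omega>) - cv v\<^sub>0\<bar> > \<epsilon>}
      \<le> measure (P a) {\<omega>\<in>space (P a). \<eta> \<le> dist ((1 / s a \<omega>) *\<^sub>R X a \<omega>) v\<^sub>0}"
    using prob
  proof eventually_elim
    case (elim a)
    then interpret prob_space "P a"
      by simp
    have [measurable]: "X a \<in> borel_measurable (P a)" "s a \<in> borel_measurable (P a)"
      using elim by auto
    have "\<bar>cv (X a \<omega>) - cv v\<^sub>0\<bar> < \<epsilon>" if "dist ((1 / s a \<omega>) *\<^sub>R X a \<omega>) v\<^sub>0 < \<eta>" for \<omega>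
    proof -
      have "s a \<omega> \<noteq> 0"
        using that by (auto simp: \<eta>_def)
      then have "cv ((1 / s a \<omega>) *\<^sub>R X a \<omega>) = cv (X a \<omega>)"
        by (intro cv_scaleR) simp
      then show ?thesis
        using d(2)[of "(1 / s a \<omega>) *\<^sub>R X a \<omega>"] that by (simp add: \<eta>_def dist_real_def)
    qed
    then have "\<eta> \<le> dist ((1 / s a \<omega>) *\<^sub>R X a \<omega>) v\<^sub>0" if "\<epsilon> < \<bar>cv (X a \<omega>) - cv v\<^sub>0\<bar>" for \<omega>
      using that by (meson not_le less_asym)
    then show ?case
      by (intro finite_measure_mono) auto
  qed
  then show "((\<lambda>a. measure (P a) {\<omega>\<in>space (P a). \<bar>cv (X a \<omega>) - cv v\<^sub>0\<bar> > \<epsilon>}) \<longlongrightarrow> 0) F"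
    by (intro tendsto_sandwich[OF _ _ tendsto_const conc[OF \<eta>]]) auto
qed

text \<open>At \<open>v\<^sub>0\<close> the mean vanishes while the variance does not, so nearby
  vectors with nonzero mean have an arbitrarily large quotient.\<close>

lemma cv_tendsto_infinity_in_prob:
  fixes X :: "'a \<Rightarrow> 'w \<Rightarrow> real ^ 'n" and v\<^sub>0 :: "real ^ 'n" and s :: "'a \<Rightarrow> 'w \<Rightarrow> real"
  assumes N: "CARD('n) \<ge> 2"
    and prob: "\<forall>\<^sub>F a in F. prob_space (P a) \<and> X a \<in> borel_measurable (P a) \<and>
      s a \<in> borel_measurable (P a)"
    and conc: "\<And>\<eta>. \<eta> > 0 \<Longrightarrow>
      ((\<lambda>a. measure (P a) {\<omega>\<in>space (P a). \<eta> \<le> dist ((1 / s a \<omega>) *\<^sub>R X a \<omega>) v\<^sub>0}) \<longlongrightarrow> 0) F"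
    and v: "v\<^sub>0 \<noteq> 0" and mean: "vmean v\<^sub>0 = 0"
    and mean_nonzero: "\<forall>\<^sub>F a in F. measure (P a) {\<omega>\<in>space (P a). vmean (X a \<omega>) = 0} = 0"
  shows "tendsto_infinity_in_prob P (\<lambda>a \<omega>. cv (X a \<omega>)) F"
  unfolding tendsto_infinity_in_prob_def
proof
  fix K :: real
  have N1: "real CARD('n) - 1 > 0"
    using N by simp
  define m where "m = sqrt (vvar v\<^sub>0)"
  have "vvar v\<^sub>0 > 0"
    using v mean N1 by (simp add: vvar_eq vmean_eq_inner)
  then have m: "m > 0"
    by (simp add: m_def)
  \<comment> \<open>The comparison is free of division and hence continuous at
    \<open>v\<^sub>0\<close>, where \<open>cv\<close> itself has the default value
    \<open>0\<close>.\<close>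
  have "isCont (\<lambda>u. sqrt (vvar u) - (\<bar>K\<bar> + 1) * \<bar>vmean u\<bar>) v\<^sub>0"
    using N by (intro continuous_intros isCont_vmean isCont_vvar) auto
  then obtain d where d: "d > 0"
    "\<And>u. dist u v\<^sub>0 < d \<Longrightarrow>
      dist (sqrt (vvar u) - (\<bar>K\<bar> + 1) * \<bar>vmean u\<bar>) (sqrt (vvar v\<^sub>0) - (\<bar>K\<bar> + 1) * \<bar>vmean v\<^sub>0\<bar>) < m"
    using m unfolding continuous_at_eps_delta by (metis dist_commute)
  have large: "cv u > K" if "dist u v\<^sub>0 < d" "vmean u \<noteq> 0" for u
  proof -
    have "(\<bar>K\<bar> + 1) * \<bar>vmean u\<bar> < sqrt (vvar u)"
      using d(2)[OF that(1)] mean by (simp add: m_def dist_real_def abs_less_iff)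
    then have "\<bar>K\<bar> + 1 < cv u"
      using that(2) by (simp add: cv_def field_simps)
    then show ?thesis
      by simp
  qed
  \<comment> \<open>Again the minimum rules out a vanishing amplitude.\<close>
  define \<eta> where "\<eta> = min d (norm v\<^sub>0)"
  have \<eta>: "\<eta> > 0"
    using d v by (simp add: \<eta>_def)
  let ?far = "\<lambda>a. {\<omega>\<in>space (P a). \<eta> \<le> dist ((1 / s a \<omega>) *\<^sub>R X a \<omega>) v\<^sub>0}"
  let ?large = "\<lambda>a. {\<omega>\<in>space (P a). cv (X a \<omega>) > K}"
  have "\<forall>\<^sub>F a in F. 1 - measure (P a) (?far a) \<le> measure (P a) (?large a)
      \<and> measure (P a) (?large a) \<le> 1"
    using prob mean_nonzero
  proof eventually_elim
    case (elim a)
    then interpret prob_space "P a"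
      by simp
    have [measurable]: "X a \<in> borel_measurable (P a)" "s a \<in> borel_measurable (P a)"
      using elim by auto
    note [measurable] = borel_measurable_cv[OF N \<open>X a \<in> borel_measurable (P a)\<close>]
    \<comment> \<open>Where the sample mean is exactly \<open>0\<close>, total division sets
      \<open>cv\<close> to \<open>0\<close>. This event is null by hypothesis and is removed
      separately.\<close>
    let ?zero = "{\<omega>\<in>space (P a). vmean (X a \<omega>) = 0}"
    have [measurable]: "?zero \<in> events"
      unfolding vmean_eq_inner by measurable
    have "\<omega> \<in> ?large a" if "\<omega> \<in> space (P a)" "\<omega> \<notin> ?far a" "\<omega> \<notin> ?zero" for \<omega>
    proof -
      have near: "dist ((1 / s a \<omega>) *\<^sub>R X a \<omega>) v\<^sub>0 < \<eta>"
        using that by auto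
      then have s: "1 / s a \<omega> \<noteq> 0"
        by (auto simp: \<eta>_def)
      show ?thesis
        using large[of "(1 / s a \<omega>) *\<^sub>R X a \<omega>"] near s that
        by (simp add: \<eta>_def vmean_scaleR cv_scaleR[OF s])
    qed
    then have "space (P a) \<subseteq> ?large a \<union> (?far a \<union> ?zero)"
      by blast
    then have "prob (space (P a)) \<le> prob (?large a \<union> (?far a \<union> ?zero))"
      by (intro finite_measure_mono) measurable
    also have "\<dots> \<le> prob (?large a) + prob (?far a \<union> ?zero)"
      by (intro measure_Un_le) measurable
    also have "prob (?far a \<union> ?zero) \<le> prob (?far a) + prob ?zero"
      by (intro measure_Un_le) measurable
    finally show ?case
      using elim by (simp add: prob_space)
  qed
  then have "\<forall>\<^sub>F a in F. 1 - measure (P a) (?far a) \<le> measure (P a) (?large a)"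
    "\<forall>\<^sub>F a in F. measure (P a) (?large a) \<le> 1"
    by (auto elim: eventually_mono)
  moreover have "((\<lambda>a. 1 - measure (P a) (?far a)) \<longlongrightarrow> 1) F"
    using tendsto_diff[OF tendsto_const conc[OF \<eta>], of 1] by simp
  ultimately show "((\<lambda>a. measure (P a) (?large a)) \<longlongrightarrow> 1) F"
    by (rule tendsto_sandwich[OF _ _ _ tendsto_const])
qed

section \<open>The linearized process near the critical parameter\<close>

text \<open>The Jacobian in \<open>x\<close> is the total derivative restricted to directions with
  parameter component \<open>0\<close>. The first derivative is itself differentiable, hence
  continuous, at the limit point, which lies in \<open>U\<close>.\<close>

lemma tendsto_jacobian:
  fixes f :: "real ^ 'n \<Rightarrow> real \<Rightarrow> real ^ 'm"
  assumes smooth: "C2_on U (\<lambda>(x, t). f x t)" and mem: "\<forall>\<^sub>F t in F. (x t, t) \<in> U" "(x\<^sub>0, t\<^sub>0) \<in> U"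
    and x: "(x \<longlongrightarrow> x\<^sub>0) F" and t: "((\<lambda>t. t) \<longlongrightarrow> t\<^sub>0) F"
  obtains J where "((\<lambda>t. jacobian (\<lambda>x. f x t) (at (x t))) \<longlongrightarrow> J) F"
proof -
  obtain D1 :: "(real ^ 'n) \<times> real \<Rightarrow> ((real ^ 'n) \<times> real) \<Rightarrow>\<^sub>L (real ^ 'm)"
    and D2 where D1: "\<And>p. p \<in> U \<Longrightarrow> ((\<lambda>(x, t). f x t) has_derivative blinfun_apply (D1 p)) (at p)"
    and D2: "\<And>p. p \<in> U \<Longrightarrow> (D1 has_derivative blinfun_apply (D2 p)) (at p)"
    using smooth unfolding C2_on_def by blast
  let ?J = "\<lambda>p. \<chi> i j. blinfun_apply (D1 p) (axis j 1, 0) $ i"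
  have jac: "jacobian (\<lambda>x. f x t) (at y) = ?J (y, t)" if "(y, t) \<in> U" for y t
  proof -
    have "((\<lambda>y. (y, t)) has_derivative (\<lambda>h. (h, 0))) (at y)"
      by (auto intro!: derivative_eq_intros)
    from has_derivative_compose[OF this D1[OF that]]
    have "((\<lambda>y. f y t) has_derivative (\<lambda>h. blinfun_apply (D1 (y, t)) (h, 0))) (at y)"
      by simp
    then have "frechet_derivative (\<lambda>y. f y t) (at y) = (\<lambda>h. blinfun_apply (D1 (y, t)) (h, 0))"
      by (rule frechet_derivative_at[symmetric])
    then show ?thesis
      by (simp add: jacobian_def matrix_def)
  qed
  have "isCont D1 (x\<^sub>0, t\<^sub>0)"
    using D2[OF mem(2)] by (rule has_derivative_continuous)
  then have "((\<lambda>t. D1 (x t, t)) \<longlongrightarrow> D1 (x\<^sub>0, t\<^sub>0)) F"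
    by (rule isCont_tendsto_compose) (intro tendsto_Pair x t)
  then have "((\<lambda>t. ?J (x t, t)) \<longlongrightarrow> ?J (x\<^sub>0, t\<^sub>0)) F"
    by (intro vec_tendstoI)
      (simp, intro tendsto_vec_nth bounded_bilinear.tendsto[OF bounded_bilinear_blinfun_apply] tendsto_const)
  moreover have "\<forall>\<^sub>F t in F. ?J (x t, t) = jacobian (\<lambda>x. f x t) (at (x t))"
    using mem(1) by eventually_elim (simp add: jac)
  ultimately have "((\<lambda>t. jacobian (\<lambda>x. f x t) (at (x t))) \<longlongrightarrow> ?J (x\<^sub>0, t\<^sub>0)) F"
    by (rule Lim_transform_eventually)
  then show thesis
    by (rule that)
qed

section \<open>Continuity of matrix operations\<close>

lemma tendsto_matrix_mult:
  fixes A :: "'a \<Rightarrow> real ^ 'n ^ 'm" and B :: "'a \<Rightarrow> real ^ 'k ^ 'n"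
  assumes "(A \<longlongrightarrow> A\<^sub>0) F" "(B \<longlongrightarrow> B\<^sub>0) F"
  shows "((\<lambda>a. A a ** B a) \<longlongrightarrow> A\<^sub>0 ** B\<^sub>0) F"
  unfolding matrix_matrix_mult_def
  by (intro vec_tendstoI) (simp, intro tendsto_sum tendsto_mult tendsto_vec_nth assms)

lemma tendsto_transpose:
  fixes A :: "'a \<Rightarrow> real ^ 'n ^ 'm"
  assumes "(A \<longlongrightarrow> A\<^sub>0) F"
  shows "((\<lambda>a. transpose (A a)) \<longlongrightarrow> transpose A\<^sub>0) F"
  unfolding transpose_def by (intro vec_tendstoI) (simp, intro tendsto_vec_nth assms)

lemma tendsto_outer:
  fixes v :: "'a \<Rightarrow> real ^ 'n" and w :: "'a \<Rightarrow> real ^ 'm"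
  assumes "(v \<longlongrightarrow> v\<^sub>0) F" "(w \<longlongrightarrow> w\<^sub>0) F"
  shows "((\<lambda>a. outer (v a) (w a)) \<longlongrightarrow> outer v\<^sub>0 w\<^sub>0) F"
  unfolding outer_def by (intro vec_tendstoI) (simp, intro tendsto_mult tendsto_vec_nth assms)

lemma tendsto_lyapunov_matrix:
  fixes A :: "'a \<Rightarrow> real ^ 'n ^ 'n"
  assumes "(A \<longlongrightarrow> A\<^sub>0) F"
  shows "((\<lambda>a. lyapunov_matrix (A a)) \<longlongrightarrow> lyapunov_matrix A\<^sub>0) F"
  unfolding lyapunov_matrix_def kron_def
  by (intro tendsto_add vec_tendstoI)
    (simp_all, (intro tendsto_mult tendsto_vec_nth assms tendsto_const)+)

lemma tendsto_vec_of:
  fixes X :: "'a \<Rightarrow> real ^ 'n ^ 'm"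
  assumes "(X \<longlongrightarrow> X\<^sub>0) F"
  shows "((\<lambda>a. vec_of (X a)) \<longlongrightarrow> vec_of X\<^sub>0) F"
  unfolding vec_of_def by (intro vec_tendstoI) (simp, intro tendsto_vec_nth assms)

section \<open>Algebra of the Lyapunov equation\<close>

lemma outer_mult_right: "outer x y ** B = outer x (y v* (B :: 'a::comm_semiring_1 ^ 'n ^ 'm))"
  by (simp add: vec_eq_iff matrix_matrix_mult_def vector_matrix_mult_def sum_distrib_left mult_ac)

lemma mult_outer_left:
  "(A :: 'a::comm_semiring_1 ^ 'n ^ 'm) ** outer x y = outer (A *v x) y"
  by (simp add: vec_eq_iff matrix_matrix_mult_def matrix_vector_mult_def sum_distrib_left mult_ac)

text \<open>\<open>\<Theta>\<close> commutes with \<open>M\<close>, since \<open>v\<close> and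
  \<open>w\<close> belong to the same eigenvalue, and \<open>w v* \<Theta> = 0\<close> kills the
  rank one term. Hence \<open>M' ** \<Theta> = \<Theta> ** M\<close>, and the equation follows on
  multiplying the original one by \<open>\<Theta>\<close> and its transpose.\<close>

lemma lyapunov_deflated:
  fixes M C D :: "real ^ 'n ^ 'n" and d :: real
  assumes lyapunov: "M ** C + C ** transpose M = D"
    and v: "M *v v = l *\<^sub>R v" and w: "w v* M = l *\<^sub>R w" and wv: "w \<bullet> v = 1"
  defines "\<Theta> \<equiv> mat 1 - outer v w"
  defines "M' \<equiv> M + outer (d *\<^sub>R v) w"
  defines "Q \<equiv> \<Theta> ** C ** transpose \<Theta>"
  shows "M' ** Q + Q ** transpose M' = \<Theta> ** D ** transpose \<Theta>"
proof -
  have "w v* outer v w = w"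
  proof -
    have "(w v* outer v w) $ i = (w \<bullet> v) * w $ i" for i
      by (simp add: vector_matrix_mult_def inner_vec_def sum_distrib_left sum_distrib_right mult_ac)
    then show ?thesis
      by (simp add: vec_eq_iff wv)
  qed
  then have "outer (d *\<^sub>R v) w ** \<Theta> = 0"
    by (simp add: \<Theta>_def outer_mult_right vector_matrix_mult_diff_rdistrib vec_eq_iff)
  moreover have "M ** \<Theta> = \<Theta> ** M"
    unfolding \<Theta>_def
    by (simp add: matrix_sub_ldistrib matrix_sub_rdistrib outer_mult_right mult_outer_left v w vec_eq_iff)
  ultimately have M': "M' ** \<Theta> = \<Theta> ** M"
    by (simp add: M'_def matrix_add_rdistrib)
  have "M' ** Q = \<Theta> ** (M ** C) ** transpose \<Theta>"
    unfolding Q_def by (simp add: matrix_mul_assoc M')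
  moreover have "Q ** transpose M' = \<Theta> ** (C ** transpose M) ** transpose \<Theta>"
    using arg_cong[OF M', of transpose] unfolding Q_def
    by (simp add: matrix_transpose_mul matrix_mul_assoc[symmetric])
  ultimately show ?thesis
    by (simp add: matrix_add_ldistrib matrix_add_rdistrib flip: lyapunov)
qed

text \<open>Testing the equation with \<open>w\<close> on both sides turns each term into
  \<open>l * (w \<bullet> (C *v w))\<close>. The factor \<open>inverse l\<close> is kept apart
  because it is the one that diverges.\<close>

lemma lyapunov_amplitude:
  fixes M C D :: "real ^ 'n ^ 'n"
  assumes lyapunov: "M ** C + C ** transpose M = D"
    and w: "w v* M = l *\<^sub>R w" and l: "l \<noteq> 0"
  shows "w \<bullet> (C *v w) = (w \<bullet> (D *v w)) / 2 * inverse l"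
proof -
  have "w \<bullet> (D *v w) = (w v* M) \<bullet> (C *v w) + w \<bullet> (C *v (w v* M))"
    by (simp add: matrix_vector_mult_add_rdistrib inner_add_right dot_lmul_matrix
        flip: lyapunov matrix_vector_mul_assoc)
  also have "\<dots> = 2 * l * (w \<bullet> (C *v w))"
    by (simp add: w matrix_vector_mult_scaleR)
  finally show ?thesis
    using l by (simp add: field_simps)
qed

text \<open>For a covariance matrix \<open>C\<close> this is the variance of the functional given by
  row \<open>i\<close>, so entries of a transformed covariance bound variances of
  coordinates.\<close>

lemma row_mult_transpose_nth:
  fixes A :: "real ^ 'm ^ 'n"
  shows "(A ** C ** transpose A) $ i $ i = A $ i \<bullet> (C *v A $ i)"
proof -
  have "(A ** C ** transpose A) $ i $ i = (\<Sum>k\<in>UNIV. (\<Sum>j\<in>UNIV. A $ i $ j * C $ j $ k) * A $ i $ k)"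
    by (simp add: matrix_matrix_mult_def transpose_def)
  also have "\<dots> = (A $ i v* C) \<bullet> A $ i"
    by (simp add: inner_vec_def vector_matrix_mult_def mult.commute)
  finally show ?thesis
    by (simp add: dot_lmul_matrix)
qed

theorem theorem4p8:
  fixes F :: "real ^ 'n \<Rightarrow> real \<Rightarrow> real ^ 'n"
    and B :: "real ^ 'm ^ 'n"
    and xs :: "real \<Rightarrow> real ^ 'n" and x_c :: "real ^ 'n"
    and \<alpha>\<^sub>0 \<alpha>\<^sub>c \<delta> :: real
    and U :: "((real ^ 'n) \<times> real) set"
    and M C :: "real \<Rightarrow> real ^ 'n ^ 'n"
    and lam1 :: "real \<Rightarrow> real"
    and v w :: "real \<Rightarrow> real ^ 'n" and v_c w_c :: "real ^ 'n"
    and P :: "real \<Rightarrow> 'w measure" and z :: "real \<Rightarrow> 'w \<Rightarrow> real ^ 'n"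
  assumes N_ge_2: "CARD('n) \<ge> 2"
    and interval: "\<alpha>\<^sub>0 < \<alpha>\<^sub>c"
    and smooth: "C2_on U (\<lambda>(x, \<alpha>). F x \<alpha>)"
      "\<forall>\<alpha>\<in>{\<alpha>\<^sub>0<..<\<alpha>\<^sub>c}. (xs \<alpha>, \<alpha>) \<in> U" "(x_c, \<alpha>\<^sub>c) \<in> U"
    and equilibrium: "\<forall>\<alpha>\<in>{\<alpha>\<^sub>0<..<\<alpha>\<^sub>c}. F (xs \<alpha>) \<alpha> = 0"
    and stable: "\<forall>\<alpha>\<in>{\<alpha>\<^sub>0<..<\<alpha>\<^sub>c}. asymptotically_stable (\<lambda>x. F x \<alpha>) (xs \<alpha>)"
    and xs_limit: "(xs \<longlongrightarrow> x_c) (at_left \<alpha>\<^sub>c)"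
    and M_def: "\<forall>\<alpha>\<in>{\<alpha>\<^sub>0<..<\<alpha>\<^sub>c}. M \<alpha> = - jacobian (\<lambda>x. F x \<alpha>) (at (xs \<alpha>))"
    and diagonalizable: "\<forall>\<^sub>F \<alpha> in at_left \<alpha>\<^sub>c. diagonalizable (cmatrix (M \<alpha>))"
    and positive_real_parts:
      "\<forall>\<^sub>F \<alpha> in at_left \<alpha>\<^sub>c. \<forall>\<mu>\<in>eigenvalues (cmatrix (M \<alpha>)). Re \<mu> > 0"
    and lam1_simple:
      "\<forall>\<^sub>F \<alpha> in at_left \<alpha>\<^sub>c. simple_eigenvalue (cmatrix (M \<alpha>)) (complex_of_real (lam1 \<alpha>))"
    and lam1_smallest:
      "\<forall>\<^sub>F \<alpha> in at_left \<alpha>\<^sub>c. \<forall>\<mu>\<in>eigenvalues (cmatrix (M \<alpha>)). lam1 \<alpha> \<le> Re \<mu>"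
    and lam1_pos: "\<forall>\<^sub>F \<alpha> in at_left \<alpha>\<^sub>c. lam1 \<alpha> > 0"
    and lam1_limit: "(lam1 \<longlongrightarrow> 0) (at_left \<alpha>\<^sub>c)"
    and delta_pos: "\<delta> > 0"
    and spectral_gap:
      "\<forall>\<^sub>F \<alpha> in at_left \<alpha>\<^sub>c.
         \<forall>\<mu>\<in>eigenvalues (cmatrix (M \<alpha>)) - {complex_of_real (lam1 \<alpha>)}. Re \<mu> \<ge> \<delta>"
    and eigenvectors:
      "\<forall>\<^sub>F \<alpha> in at_left \<alpha>\<^sub>c. M \<alpha> *v v \<alpha> = lam1 \<alpha> *\<^sub>R v \<alpha> \<and> w \<alpha> v* M \<alpha> = lam1 \<alpha> *\<^sub>R w \<alpha> \<and>
         norm (v \<alpha>) = 1 \<and> w \<alpha> \<bullet> v \<alpha> = 1"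
    and v_limit: "(v \<longlongrightarrow> v_c) (at_left \<alpha>\<^sub>c)"
    and w_limit: "(w \<longlongrightarrow> w_c) (at_left \<alpha>\<^sub>c)"
    and stationary_covariance:
      "\<forall>\<^sub>F \<alpha> in at_left \<alpha>\<^sub>c. M \<alpha> ** C \<alpha> + C \<alpha> ** transpose (M \<alpha>) = B ** transpose B"
    and z_gaussian: "\<forall>\<^sub>F \<alpha> in at_left \<alpha>\<^sub>c. gaussian_vector (P \<alpha>) (z \<alpha>) 0 (C \<alpha>)"
    and sigma_eff_pos: "w_c \<bullet> ((B ** transpose B) *v w_c) > 0"
    and mean_nonzero:
      "\<forall>\<^sub>F \<alpha> in at_left \<alpha>\<^sub>c. measure (P \<alpha>) {\<omega>\<in>space (P \<alpha>). vmean (xs \<alpha> + z \<alpha> \<omega>) = 0} = 0"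
  shows "let N = real CARD('n);
             \<rho>\<^sub>c = ((1 :: real ^ 'n) \<bullet> v_c)\<^sup>2 / N;
             CV = (\<lambda>\<alpha> \<omega>. cv (xs \<alpha> + z \<alpha> \<omega>))
         in \<rho>\<^sub>c \<in> {0..1} \<and>
            (0 < \<rho>\<^sub>c \<and> \<rho>\<^sub>c < 1 \<longrightarrow>
               tendsto_in_prob P CV (sqrt (N * (1 - \<rho>\<^sub>c) / ((N - 1) * \<rho>\<^sub>c))) (at_left \<alpha>\<^sub>c)) \<and>
            (\<rho>\<^sub>c = 1 \<longrightarrow> tendsto_in_prob P CV 0 (at_left \<alpha>\<^sub>c)) \<and>
            (\<rho>\<^sub>c = 0 \<longrightarrow> tendsto_infinity_in_prob P CV (at_left \<alpha>\<^sub>c))"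
proof -
  let ?F = "at_left \<alpha>\<^sub>c" and ?D = "B ** transpose B"
  let ?\<Theta> = "\<lambda>\<alpha>. mat 1 - outer (v \<alpha>) (w \<alpha>)"
  let ?M' = "\<lambda>\<alpha>. M \<alpha> + outer (\<delta> *\<^sub>R v \<alpha>) (w \<alpha>)"
  let ?Q = "\<lambda>\<alpha>. ?\<Theta> \<alpha> ** C \<alpha> ** transpose (?\<Theta> \<alpha>)"
  let ?x = "\<lambda>\<alpha> \<omega>. xs \<alpha> + z \<alpha> \<omega>" and ?s = "\<lambda>\<alpha> \<omega>. w \<alpha> \<bullet> z \<alpha> \<omega>"
  have near: "\<forall>\<^sub>F \<alpha> in ?F. \<alpha> \<in> {\<alpha>\<^sub>0<..<\<alpha>\<^sub>c}"
    using interval by (rule eventually_at_leftI[rotated]) simp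
  have v: "\<forall>\<^sub>F \<alpha> in ?F. M \<alpha> *v v \<alpha> = lam1 \<alpha> *\<^sub>R v \<alpha>"
    and w: "\<forall>\<^sub>F \<alpha> in ?F. w \<alpha> v* M \<alpha> = lam1 \<alpha> *\<^sub>R w \<alpha>"
    and norm_v: "\<forall>\<^sub>F \<alpha> in ?F. norm (v \<alpha>) = 1" and wv: "\<forall>\<^sub>F \<alpha> in ?F. w \<alpha> \<bullet> v \<alpha> = 1"
    using eigenvectors by (auto elim: eventually_mono)
  \<comment> \<open>Unit length survives in the limit, as the formula for \<open>cv v_c\<close>
    requires.\<close>
  have "((\<lambda>\<alpha>. norm (v \<alpha>)) \<longlongrightarrow> 1) ?F"
    by (rule tendsto_eventually[OF norm_v])
  then have norm_vc: "norm v_c = 1"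
    using tendsto_norm[OF v_limit] tendsto_unique trivial_limit_at_left_real by blast

  \<comment> \<open>Boundedness of the residual covariance\<close>
  have "\<forall>\<^sub>F \<alpha> in ?F. (xs \<alpha>, \<alpha>) \<in> U"
    using near smooth(2) by (auto elim: eventually_mono)
  then obtain J where "((\<lambda>\<alpha>. jacobian (\<lambda>x. F x \<alpha>) (at (xs \<alpha>))) \<longlongrightarrow> J) ?F"
    using tendsto_jacobian[OF smooth(1) _ smooth(3) xs_limit tendsto_ident_at] by blast
  moreover have "\<forall>\<^sub>F \<alpha> in ?F. - jacobian (\<lambda>x. F x \<alpha>) (at (xs \<alpha>)) = M \<alpha>"
    using near M_def by (auto elim: eventually_mono)
  ultimately have M: "(M \<longlongrightarrow> - J) ?F"
    using tendsto_minus Lim_transform_eventually by blast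
  have \<Theta>: "(?\<Theta> \<longlongrightarrow> mat 1 - outer v_c w_c) ?F"
    by (intro tendsto_diff tendsto_const tendsto_outer v_limit w_limit)
  have \<Theta>D: "((\<lambda>\<alpha>. ?\<Theta> \<alpha> ** ?D ** transpose (?\<Theta> \<alpha>)) \<longlongrightarrow>
      (mat 1 - outer v_c w_c) ** ?D ** transpose (mat 1 - outer v_c w_c)) ?F"
    by (intro tendsto_matrix_mult tendsto_transpose \<Theta> tendsto_const)
  have M': "(?M' \<longlongrightarrow> - J + outer (\<delta> *\<^sub>R v_c) w_c) ?F"
    by (intro tendsto_add M tendsto_outer tendsto_scaleR tendsto_const v_limit w_limit)
  \<comment> \<open>The lower bound depends only on \<delta> and the dimension, so it is uniform in
    the parameter.\<close>
  have det: "\<forall>\<^sub>F \<alpha> in ?F. \<bar>det (lyapunov_matrix (?M' \<alpha>))\<bar> \<ge> (2 * \<delta>) ^ CARD('n \<times> 'n)"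
    using diagonalizable lam1_simple lam1_pos spectral_gap v w wv
    by eventually_elim (intro abs_det_lyapunov_matrix_ge delta_pos, auto)
  have system: "\<forall>\<^sub>F \<alpha> in ?F. lyapunov_matrix (?M' \<alpha>) *v vec_of (?Q \<alpha>)
      = vec_of (?\<Theta> \<alpha> ** ?D ** transpose (?\<Theta> \<alpha>))"
    using stationary_covariance v w wv
    by eventually_elim
      (simp only: lyapunov_matrix_mult_vec_of, subst lyapunov_deflated, assumption+, rule refl)
  \<comment> \<open>This variance is a diagonal entry of \<open>?Q \<alpha>\<close>, that is, a
    single component of the linear system.\<close>
  have tight: "\<exists>R. \<forall>\<^sub>F \<alpha> in ?F. ?\<Theta> \<alpha> $ i \<bullet> (C \<alpha> *v ?\<Theta> \<alpha> $ i) \<le> R" for i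
  proof -
    have "(2 * \<delta>) ^ CARD('n \<times> 'n) > 0"
      using delta_pos by simp
    from linear_system_solution_bounded[OF tendsto_lyapunov_matrix[OF M'] tendsto_vec_of[OF \<Theta>D]
        this det system, of "(i, i)"]
    obtain R where "\<forall>\<^sub>F \<alpha> in ?F. \<bar>vec_of (?Q \<alpha>) $ (i, i)\<bar> \<le> R" .
    then have "\<forall>\<^sub>F \<alpha> in ?F. ?Q \<alpha> $ i $ i \<le> R"
      by eventually_elim (simp add: vec_of_def)
    then show ?thesis
      unfolding row_mult_transpose_nth by blast
  qed

  \<comment> \<open>Divergence of the amplitude variance\<close>
  have "((\<lambda>\<alpha>. (w \<alpha> \<bullet> (?D *v w \<alpha>)) / 2) \<longlongrightarrow> (w_c \<bullet> (?D *v w_c)) / 2) ?F"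
    by (intro tendsto_divide tendsto_const tendsto_inner w_limit
        bounded_linear.tendsto[OF matrix_vector_mul_bounded_linear]) simp
  moreover have "(w_c \<bullet> (?D *v w_c)) / 2 > 0"
    using sigma_eff_pos by simp
  moreover have "filterlim (\<lambda>\<alpha>. inverse (lam1 \<alpha>)) at_top ?F"
    by (rule filterlim_inverse_at_top[OF lam1_limit lam1_pos])
  ultimately have "filterlim (\<lambda>\<alpha>. (w \<alpha> \<bullet> (?D *v w \<alpha>)) / 2 * inverse (lam1 \<alpha>)) at_top ?F"
    by (rule filterlim_tendsto_pos_mult_at_top)
  moreover have "\<forall>\<^sub>F \<alpha> in ?F. (w \<alpha> \<bullet> (?D *v w \<alpha>)) / 2 * inverse (lam1 \<alpha>) = w \<alpha> \<bullet> (C \<alpha> *v w \<alpha>)"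
    using stationary_covariance w lam1_pos by eventually_elim (rule lyapunov_amplitude[symmetric], auto)
  ultimately have amplitude: "filterlim (\<lambda>\<alpha>. w \<alpha> \<bullet> (C \<alpha> *v w \<alpha>)) at_top ?F"
    by (rule filterlim_mono_eventually[OF _ order_refl order_refl])

  \<comment> \<open>Limits of the coefficient of variation\<close>
  have proj: "?\<Theta> \<alpha> $ i \<bullet> y = (y - (w \<alpha> \<bullet> y) *\<^sub>R v \<alpha>) $ i" for \<alpha> i y
  proof -
    have "?\<Theta> \<alpha> $ i \<bullet> y = (\<Sum>j\<in>UNIV. if i = j then y $ j else 0) - (\<Sum>j\<in>UNIV. v \<alpha> $ i * w \<alpha> $ j * y $ j)"
      unfolding inner_vec_def sum_subtractf[symmetric]
      by (rule sum.cong) (auto simp: mat_def left_diff_distrib)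
    then show ?thesis
      by (simp add: inner_vec_def sum_distrib_left mult_ac)
  qed
  \<comment> \<open>Row \<open>i\<close> of \<open>?\<Theta> \<alpha>\<close> serves as the
    functional \<open>q\<close>: it reads off coordinate \<open>i\<close> of the residual
    fluctuation.\<close>
  note conc = gaussian_direction_concentrates[OF z_gaussian v_limit xs_limit amplitude proj tight]
  have prob: "\<forall>\<^sub>F \<alpha> in ?F. prob_space (P \<alpha>) \<and> ?x \<alpha> \<in> borel_measurable (P \<alpha>) \<and>
      ?s \<alpha> \<in> borel_measurable (P \<alpha>)"
    using z_gaussian
    by eventually_elim (auto simp: gaussian_vector_def)

  define \<rho> where "\<rho> = ((1 :: real ^ 'n) \<bullet> v_c)\<^sup>2 / real CARD('n)"
  have \<rho>01: "\<rho> \<in> {0..1}"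
    using inner_one_squared_le[OF norm_vc] by (simp add: \<rho>_def)
  have vc0: "v_c \<noteq> 0"
    using norm_vc by auto
  have mean_iff: "vmean v_c = 0 \<longleftrightarrow> \<rho> = 0"
    by (simp add: \<rho>_def vmean_eq_inner)
  have cv_vc: "cv v_c = sqrt (real CARD('n) * (1 - \<rho>) / ((real CARD('n) - 1) * \<rho>))"
    unfolding \<rho>_def by (rule cv_unit_vector[OF norm_vc])
  \<comment> \<open>This covers both cases with nonzero \<open>\<rho>\<close>: for
    \<open>\<rho> = 1\<close> the formula \<open>cv_vc\<close> evaluates to
    \<open>0\<close>.\<close>
  have finite: "tendsto_in_prob P (\<lambda>\<alpha> \<omega>. cv (?x \<alpha> \<omega>)) (cv v_c) ?F" if "\<rho> \<noteq> 0"
    using cv_tendsto_in_prob[OF N_ge_2 prob conc vc0] mean_iff that by blast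
  have infinite: "tendsto_infinity_in_prob P (\<lambda>\<alpha> \<omega>. cv (?x \<alpha> \<omega>)) ?F" if "\<rho> = 0"
    using cv_tendsto_infinity_in_prob[OF N_ge_2 prob conc vc0 _ mean_nonzero] mean_iff that by blast
  show ?thesis
    unfolding Let_def \<rho>_def[symmetric]
    using \<rho>01 finite infinite cv_vc by auto
qed

end
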